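(* (i) Let $\nu\ge 0$ and $c>4/3$ be fixed real numbers. For all large enough positive integers $k$ (depending on $\nu$ and $c$) and any graph $G$ with at least $k^{c10^6\nu^2+4/3}$ vertices, $G$ or $\overline{G}$ has an induced subgraph $H$ on $\ell\ge k$ vertices with minimum degree at least $\frac12(\ell-1)+\nu\sqrt{(\ell-1)\ln \ell}$. (ii) There is a constant $C>0$ such that, if $\nu(\cdot)$ is a non-decreasing non-negative real-valued function on the positive integers, then for all large enough $k$ (depending on the function $\nu$) there is a graph $G$ with at least $Ck^{\nu(k)^2+1}$ vertices such that the following holds: if $H$ is any induced subgraph of $G$ or $\overline{G}$ on $\ell\ge k$ vertices, then $H$ has minimum degree less than $\frac12(\ell-1)+\nu(\ell)\sqrt{(\ell-1)\ln \ell}$.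
   Context: Graphs are finite and simple. $\overline{G}$ denotes the complement of the graph $G$. $\ln$ is the natural logarithm. In $c10^6\nu^2+4/3$ the leading term is the product $c\cdot 10^6\cdot\nu^2$. *)

theory Defs
  imports Complex_Main "Graph_Theory.Digraph_Component"
begin

text \<open>
  A finite simple graph is a \<open>pair_graph\<close>: a finite vertex set together with a finite,
  symmetric, irreflexive set of arcs. Each undirected edge is represented by its two
  orientations, so the degree of a vertex is its out-degree.
\<close>

definition complement :: "'a pair_pre_digraph \<Rightarrow> 'a pair_pre_digraph" where
  "complement G = \<lparr> pverts = pverts G,
     parcs = {(u, v). u \<in> pverts G \<and> v \<in> pverts G \<and> u \<noteq> v \<and> (u, v) \<notin> parcs G} \<rparr>"

text \<open>The minimum is meaningful only for finite graphs with at least one vertex.\<close>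

definition min_degree :: "'a pair_pre_digraph \<Rightarrow> nat" where
  "min_degree G = (MIN v\<in>pverts G. out_degree (with_proj G) v)"

lemma pair_graph_complement:
  assumes "pair_graph G"
  shows "pair_graph (complement G)"
proof -
  interpret pair_graph G by fact
  have "finite (parcs (complement G))"
    by (rule finite_subset[of _ "pverts G \<times> pverts G"]) (auto simp: complement_def)
  moreover have "symmetric (with_proj (complement G))"
    by (auto simp: symmetric_def complement_def sym_def intro: arcs_symmetric)
  ultimately show ?thesis
    by unfold_locales (auto simp: complement_def)
qed

end

theory Submission
  imports Defs "HOL-Library.Disjoint_Sets" "HOL-Library.FuncSet" "HOL-Real_Asymp.Real_Asymp"
begin

text \<open>
  Write \<open>\<sigma> u v = 1\<close> for an edge and \<open>\<sigma> u v = -1\<close> for a non-edge, and let \<open>disc \<sigma> X\<close> be the sum of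
  \<open>\<sigma>\<close> over all ordered pairs in \<open>X\<close>. A vertex of \<open>X\<close> has degree \<open>(\<bar>X\<bar> - 1) / 2\<close> plus half its row sum
  in \<open>X\<close>, and passing to the complement negates \<open>\<sigma>\<close>. Both parts are statements about \<open>disc\<close>.

  Upper bound. Choose \<open>X\<close> maximising the skew discrepancy \<open>\<bar>disc \<sigma> X\<bar> - 4 \<nu> w(\<bar>X\<bar>)\<close>, where \<open>w\<close> has increments
  \<open>sqrt ((l - 1) ln l)\<close>. Deleting a vertex does not increase this quantity, which forces
  every degree in \<open>X\<close> to be as large as required, in the graph or in its complement
  (\<open>small_maximiser_of_skew_disc\<close>). If all such sets have fewer than \<open>k\<close> vertices, then
  \<open>\<bar>disc \<sigma> Y\<bar> \<le> k\<^sup>2 + 4 \<nu> w(\<bar>Y\<bar>)\<close> for every \<open>Y\<close>. On the other hand a graph on \<open>n\<close> vertices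
  contains sets \<open>Y\<close> of order \<open>m\<close> whose discrepancy is at least a constant times
  \<open>m powr (3/2) * sqrt (ln (n / m))\<close> (\<open>exists_large_disc\<close>): a suitable set \<open>A\<close> gives many vertices \<open>v\<close>
  an unusually large sum over \<open>A\<close>, and those \<open>v\<close> form the other side of a pair of sets with large cross sum.
  For \<open>\<nu> > 0\<close>, take \<open>m\<close> slightly above \<open>k powr (4/3)\<close>, so that \<open>k\<^sup>2\<close> is at most \<open>m powr (3/2)\<close>. Then
  \<open>sqrt (ln (n / m))\<close> is of order \<open>1000 \<nu> sqrt (ln k)\<close>, whereas the penalty only contributes a factor of order
  \<open>\<nu> sqrt (ln m)\<close>, and the lower bound contradicts the upper one. For \<open>\<nu> = 0\<close> the two bounds differ only by a
  constant factor, and the contradiction comes from many disjoint small sets of discrepancy of order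
  \<open>k\<^sup>2\<close>: the average discrepancy of the union of a random subfamily grows with their number.

  Lower bound. In a uniformly random graph on \<open>n\<close> vertices a set of order \<open>l\<close> whose
  minimum degree reaches the threshold has discrepancy at least \<open>2 \<nu> l sqrt ((l - 1) ln l)\<close>, and by Chernoff's
  inequality this has probability at most \<open>l powr (- \<nu>\<^sup>2 l)\<close>. There are about \<open>(n / l) ^ l\<close> sets of order \<open>l\<close>, up
  to a factor exponential in \<open>l\<close>, so a union bound succeeds up to \<open>n\<close> of order \<open>k powr (\<nu>\<^sup>2 + 1)\<close>
  (\<open>exists_graph_of_small_disc\<close>).
\<close>

section \<open>Sums with random signs\<close>

text \<open>
  A choice of signs on \<open>S\<close> is encoded by the set \<open>A\<close> of indices with sign plus, so that averages over
  random signs are sums over \<open>Pow S\<close>.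
\<close>

definition signed_sum :: "('a \<Rightarrow> real) \<Rightarrow> 'a set \<Rightarrow> 'a set \<Rightarrow> real" where
  "signed_sum g S A = (\<Sum>u\<in>S. if u \<in> A then g u else - g u)"

lemma sum_Pow_insert:
  fixes F :: "'a set \<Rightarrow> 'b :: comm_monoid_add"
  assumes "finite S" "x \<notin> S"
  shows "sum F (Pow (insert x S)) = (\<Sum>A\<in>Pow S. F A + F (insert x A))"
proof -
  have "Pow S \<inter> insert x ` Pow S = {}" using assms by auto
  moreover have "inj_on (insert x) (Pow S)" using assms by (auto simp: inj_on_def)
  ultimately show ?thesis
    using assms by (simp add: Pow_insert sum.union_disjoint sum.reindex sum.distrib)
qed

lemma signed_sum_insert:
  assumes "finite S" "x \<notin> S" "A \<subseteq> S"
  shows "signed_sum g (insert x S) A = signed_sum g S A - g x"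
    and "signed_sum g (insert x S) (insert x A) = signed_sum g S A + g x"
proof -
  have "x \<notin> A" using assms by auto
  then show "signed_sum g (insert x S) A = signed_sum g S A - g x"
    using assms by (simp add: signed_sum_def)
  have "(\<Sum>u\<in>S. if u \<in> insert x A then g u else - g u) = (\<Sum>u\<in>S. if u \<in> A then g u else - g u)"
    using assms by (intro sum.cong) auto
  then show "signed_sum g (insert x S) (insert x A) = signed_sum g S A + g x"
    using assms by (simp add: signed_sum_def)
qed

lemma second_moment_signed_sum:
  assumes "finite S" "\<And>u. u \<in> S \<Longrightarrow> \<bar>g u\<bar> = 1"
  shows "(\<Sum>A\<in>Pow S. (signed_sum g S A)\<^sup>2) = real (card S) * 2 ^ card S"
  using assms
proof (induction S rule: finite_induct)
  case empty
  then show ?case by (simp add: signed_sum_def)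
next
  case (insert x S)
  have gx: "g x * g x = 1" using insert.prems[of x] by (auto simp: abs_if split: if_splits)
  have "(\<Sum>A\<in>Pow (insert x S). (signed_sum g (insert x S) A)\<^sup>2)
      = (\<Sum>A\<in>Pow S. (signed_sum g S A - g x)\<^sup>2 + (signed_sum g S A + g x)\<^sup>2)"
    unfolding sum_Pow_insert[OF insert.hyps]
    by (intro sum.cong) (auto simp: signed_sum_insert insert.hyps)
  also have "\<dots> = (\<Sum>A\<in>Pow S. 2 * (signed_sum g S A)\<^sup>2 + 2)"
    by (intro sum.cong) (auto simp: power2_eq_square algebra_simps gx)
  also have "\<dots> = 2 * (\<Sum>A\<in>Pow S. (signed_sum g S A)\<^sup>2) + 2 * 2 ^ card S"
    using insert.hyps by (simp add: sum.distrib sum_distrib_left card_Pow)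
  finally show ?case using insert by (simp add: algebra_simps)
qed

lemma fourth_moment_signed_sum:
  assumes "finite S" "\<And>u. u \<in> S \<Longrightarrow> \<bar>g u\<bar> = 1"
  shows "(\<Sum>A\<in>Pow S. (signed_sum g S A) ^ 4)
    = (3 * (real (card S))\<^sup>2 - 2 * real (card S)) * 2 ^ card S"
  using assms
proof (induction S rule: finite_induct)
  case empty
  then show ?case by (simp add: signed_sum_def)
next
  case (insert x S)
  have gx: "g x * g x = 1" using insert.prems[of x] by (auto simp: abs_if split: if_splits)
  have poly: "(r - g x) ^ 4 + (r + g x) ^ 4 = 2 * r ^ 4 + 12 * r\<^sup>2 + 2" for r
  proof -
    have "(r - g x) ^ 4 + (r + g x) ^ 4
      = 2 * r ^ 4 + 12 * r\<^sup>2 * (g x * g x) + 2 * ((g x * g x) * (g x * g x))"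
      by (simp add: power4_eq_xxxx power2_eq_square algebra_simps)
    then show ?thesis by (simp add: gx)
  qed
  have "(\<Sum>A\<in>Pow (insert x S). (signed_sum g (insert x S) A) ^ 4)
      = (\<Sum>A\<in>Pow S. (signed_sum g S A - g x) ^ 4 + (signed_sum g S A + g x) ^ 4)"
    unfolding sum_Pow_insert[OF insert.hyps]
    by (intro sum.cong) (auto simp: signed_sum_insert insert.hyps)
  also have "\<dots> = (\<Sum>A\<in>Pow S. 2 * (signed_sum g S A) ^ 4 + 12 * (signed_sum g S A)\<^sup>2 + 2)"
    by (simp add: poly)
  also have "\<dots> = 2 * (\<Sum>A\<in>Pow S. (signed_sum g S A) ^ 4)
      + 12 * (\<Sum>A\<in>Pow S. (signed_sum g S A)\<^sup>2) + 2 * 2 ^ card S"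
    using insert.hyps by (simp add: sum.distrib sum_distrib_left card_Pow)
  also have "(\<Sum>A\<in>Pow S. (signed_sum g S A) ^ 4)
      = (3 * (real (card S))\<^sup>2 - 2 * real (card S)) * 2 ^ card S"
    using insert.prems by (intro insert.IH) auto
  also have "(\<Sum>A\<in>Pow S. (signed_sum g S A)\<^sup>2) = real (card S) * 2 ^ card S"
    using insert.hyps insert.prems by (intro second_moment_signed_sum) auto
  finally show ?case
    using insert.hyps by (simp add: algebra_simps power2_eq_square)
qed

lemma signed_sum_compl:
  assumes "A \<subseteq> S"
  shows "signed_sum g S (S - A) = - signed_sum g S A"
  unfolding signed_sum_def sum_negf[symmetric] by (intro sum.cong) auto

text \<open>
  A sum of \<open>b\<close> independent signs reaches half its standard deviation \<open>sqrt b\<close> with probability bounded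
  away from 0, because its fourth moment is at most three times the square of its second moment
  (the Paley-Zygmund argument).
\<close>

lemma signed_sum_anticoncentration:
  assumes "finite S" "\<And>u. u \<in> S \<Longrightarrow> \<bar>g u\<bar> = 1"
  shows "2 ^ card S \<le> 16 * card {A \<in> Pow S. sqrt (card S) / 2 \<le> signed_sum g S A}"
proof (cases "card S = 0")
  case True
  then have "S = {}" using assms by simp
  then show ?thesis by (simp add: signed_sum_def)
next
  case False
  define b where "b = real (card S)"
  have b: "b \<ge> 1" using False by (simp add: b_def)
  define r where "r A = signed_sum g S A" for A
  define P where "P = {A \<in> Pow S. sqrt b / 2 \<le> r A}"
  define Q where "Q = {A \<in> Pow S. r A \<le> - (sqrt b / 2)}"
  have fin: "finite P" "finite Q" using assms by (auto simp: P_def Q_def)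
  have "card Q = card P"
  proof (rule bij_betw_same_card[of "\<lambda>A. S - A"])
    show "bij_betw (\<lambda>A. S - A) Q P"
      by (rule bij_betwI[where g = "\<lambda>A. S - A"])
        (auto simp: P_def Q_def r_def signed_sum_compl double_diff)
  qed
  \<comment> \<open>A parabola in \<open>r\<^sup>2\<close> that lies below \<open>9 b\<^sup>2\<close> times the indicator of \<open>r\<^sup>2 \<ge> b / 4\<close>; its mean
    involves only the two known moments.\<close>
  define q where "q A = ((r A)\<^sup>2 - b / 4) * (25 / 4 * b - (r A)\<^sup>2)" for A
  have q_le: "q A \<le> 9 * b\<^sup>2 * (of_bool (A \<in> P) + of_bool (A \<in> Q))" if "A \<in> Pow S" for A
  proof (cases "(r A)\<^sup>2 < b / 4")
    case True
    then have "q A \<le> 0" using b unfolding q_def by (intro mult_nonpos_nonneg) auto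
    then show ?thesis by (simp add: order_trans[of _ 0])
  next
    case False
    then have "(sqrt b / 2)\<^sup>2 \<le> \<bar>r A\<bar>\<^sup>2" using b by (simp add: power_divide)
    then have "sqrt b / 2 \<le> \<bar>r A\<bar>" by (rule power2_le_imp_le) auto
    then have "A \<in> P \<or> A \<in> Q" using that by (auto simp: P_def Q_def)
    have "q A \<le> 9 * b\<^sup>2"
    proof -
      have "9 * b\<^sup>2 - q A = ((r A)\<^sup>2 - 13 / 4 * b)\<^sup>2"
        by (simp add: q_def power2_eq_square field_simps)
      then show ?thesis using zero_le_power2[of "(r A)\<^sup>2 - 13 / 4 * b"] by linarith
    qed
    moreover have "9 * b\<^sup>2 * 1 \<le> 9 * b\<^sup>2 * (of_bool (A \<in> P) + of_bool (A \<in> Q))"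
      using \<open>A \<in> P \<or> A \<in> Q\<close> by (intro mult_left_mono) auto
    ultimately show ?thesis by linarith
  qed
  have "(\<Sum>A\<in>Pow S. q A) \<le> (\<Sum>A\<in>Pow S. 9 * b\<^sup>2 * (of_bool (A \<in> P) + of_bool (A \<in> Q)))"
    by (intro sum_mono q_le)
  also have "\<dots> = 9 * b\<^sup>2 * (card P + card Q)"
  proof -
    have "Pow S \<inter> P = P" "Pow S \<inter> Q = Q" by (auto simp: P_def Q_def)
    then show ?thesis
      using assms by (simp add: sum_distrib_left[symmetric] sum.distrib)
  qed
  also have "\<dots> = 18 * b\<^sup>2 * card P" using \<open>card Q = card P\<close> by simp
  finally have upper: "(\<Sum>A\<in>Pow S. q A) \<le> 18 * b\<^sup>2 * card P" .
  have "(\<Sum>A\<in>Pow S. q A)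
      = (\<Sum>A\<in>Pow S. 13 / 2 * b * (r A)\<^sup>2 - (r A) ^ 4 - 25 / 16 * b\<^sup>2)"
    by (intro sum.cong) (simp_all add: q_def power2_eq_square power4_eq_xxxx field_simps)
  also have "\<dots> = 13 / 2 * b * (\<Sum>A\<in>Pow S. (r A)\<^sup>2) - (\<Sum>A\<in>Pow S. (r A) ^ 4)
      - 25 / 16 * b\<^sup>2 * 2 ^ card S"
    using assms by (simp add: sum_subtractf sum_distrib_left card_Pow)
  also have "\<dots> = (31 / 16 * b\<^sup>2 + 2 * b) * 2 ^ card S"
  proof -
    have "(\<Sum>A\<in>Pow S. (r A)\<^sup>2) = b * 2 ^ card S"
      unfolding r_def b_def using assms by (rule second_moment_signed_sum)
    moreover have "(\<Sum>A\<in>Pow S. (r A) ^ 4) = (3 * b\<^sup>2 - 2 * b) * 2 ^ card S"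
      unfolding r_def b_def using assms by (rule fourth_moment_signed_sum)
    ultimately show ?thesis by (simp only:) (simp add: power2_eq_square field_simps)
  qed
  finally have "(31 / 16 * b\<^sup>2 + 2 * b) * 2 ^ card S \<le> 18 * b\<^sup>2 * card P"
    using upper by simp
  have weaken: "18 / 16 * b\<^sup>2 \<le> 31 / 16 * b\<^sup>2 + 2 * b"
    using b zero_le_power2[of b] by linarith
  have "18 / 16 * b\<^sup>2 * 2 ^ card S \<le> (31 / 16 * b\<^sup>2 + 2 * b) * 2 ^ card S"
    using weaken by (rule mult_right_mono) simp
  also note \<open>\<dots> \<le> 18 * b\<^sup>2 * card P\<close>
  finally have "b\<^sup>2 * (18 * 2 ^ card S) \<le> b\<^sup>2 * (18 * (16 * card P))"
    by simp
  then have "real (2 ^ card S) \<le> real (16 * card P)"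
    using b by (subst (asm) mult_le_cancel_left_pos) auto
  then show ?thesis unfolding P_def r_def b_def of_nat_le_iff .
qed

section \<open>Sets of large discrepancy\<close>

text \<open>
  Averaging \<open>signed_sum_anticoncentration\<close> over the columns \<open>v \<in> W\<close>: some single choice of signs serves a
  sixteenth of them at once.
\<close>

lemma exists_set_of_signs_good_for_many:
  assumes "finite S" "finite W" "\<And>u v. u \<in> S \<Longrightarrow> v \<in> W \<Longrightarrow> \<bar>\<sigma> u v\<bar> = 1"
  shows "\<exists>A\<subseteq>S. card W \<le> 16 * card {v \<in> W. sqrt (card S) / 2 \<le> signed_sum (\<lambda>u. \<sigma> u v) S A}"
proof (rule ccontr)
  define good where "good A v \<longleftrightarrow> sqrt (card S) / 2 \<le> signed_sum (\<lambda>u. \<sigma> u v) S A" for A v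
  assume "\<not> ?thesis"
  then have few: "16 * card {v \<in> W. good A v} < card W" if "A \<in> Pow S" for A
    using that by (auto simp: good_def not_le)
  have "2 ^ card S * card W \<le> (\<Sum>v\<in>W. 16 * card {A \<in> Pow S. good A v})"
  proof -
    have "(\<Sum>v\<in>W. 2 ^ card S) \<le> (\<Sum>v\<in>W. 16 * card {A \<in> Pow S. good A v})"
      unfolding good_def using assms by (intro sum_mono signed_sum_anticoncentration) auto
    then show ?thesis by (simp add: mult.commute)
  qed
  also have "\<dots> = (\<Sum>v\<in>W. \<Sum>A\<in>Pow S. 16 * of_bool (good A v))"
    using assms by (simp add: sum_distrib_left[symmetric] Int_def)
  also have "\<dots> = (\<Sum>A\<in>Pow S. \<Sum>v\<in>W. 16 * of_bool (good A v))"
    by (rule sum.swap)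
  also have "\<dots> = (\<Sum>A\<in>Pow S. 16 * card {v \<in> W. good A v})"
    using assms by (simp add: sum_distrib_left[symmetric] Int_def)
  also have "\<dots> < (\<Sum>A\<in>Pow S. card W)"
    using assms few by (intro sum_strict_mono) auto
  also have "\<dots> = 2 ^ card S * card W" using assms by (simp add: card_Pow)
  finally show False by simp
qed

lemma signed_sum_union_blocks:
  assumes "finite S" "T \<subseteq> S" "A \<subseteq> T" "B \<subseteq> S - T"
  shows "signed_sum g S (A \<union> B) = signed_sum g T A + signed_sum g (S - T) B"
proof -
  have "signed_sum g S (A \<union> B)
      = (\<Sum>u\<in>T. if u \<in> A \<union> B then g u else - g u) + (\<Sum>u\<in>S - T. if u \<in> A \<union> B then g u else - g u)"
    unfolding signed_sum_def by (subst sum.subset_diff[OF assms(2,1)]) (rule add.commute)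
  also have "(\<Sum>u\<in>T. if u \<in> A \<union> B then g u else - g u) = signed_sum g T A"
    unfolding signed_sum_def using assms by (intro sum.cong) auto
  also have "(\<Sum>u\<in>S - T. if u \<in> A \<union> B then g u else - g u) = signed_sum g (S - T) B"
    unfolding signed_sum_def using assms by (intro sum.cong) auto
  finally show ?thesis .
qed

text \<open>
  Large deviations by iteration: \<open>S\<close> is cut into \<open>j\<close> blocks of size \<open>b\<close>. Each block adds \<open>sqrt b / 2\<close> to
  the deviation and costs a factor 16 in the number of surviving columns. In terms of
  \<open>c = sqrt j / 2\<close>, a deviation \<open>c * sqrt (card S)\<close> is reached on a fraction \<open>exp (- K * c\<^sup>2)\<close> of the columns for a
  constant \<open>K\<close>, which is the Gaussian rate up to that constant.
\<close>

lemma exists_set_with_large_deviations: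
  assumes "finite S" "finite W" "card S = j * b"
    and "\<And>u v. u \<in> S \<Longrightarrow> v \<in> W \<Longrightarrow> \<bar>\<sigma> u v\<bar> = 1"
  shows "\<exists>A\<subseteq>S. \<exists>U\<subseteq>W. card W \<le> 16 ^ j * card U \<and>
    (\<forall>v\<in>U. j * sqrt b / 2 \<le> signed_sum (\<lambda>u. \<sigma> u v) S A)"
  using assms
proof (induction j arbitrary: S)
  case 0
  then show ?case by (auto simp: signed_sum_def)
next
  case (Suc j)
  obtain T where T: "T \<subseteq> S" "card T = b"
    using Suc.prems(3) obtain_subset_with_card_n[of b S] by auto
  have "finite T" using T Suc.prems(1) finite_subset by blast
  then have "card (S - T) = j * b" using T Suc.prems by (simp add: card_Diff_subset)
  then obtain B U where B: "B \<subseteq> S - T" and U: "U \<subseteq> W" "card W \<le> 16 ^ j * card U"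
    and dev_B: "\<And>v. v \<in> U \<Longrightarrow> j * sqrt b / 2 \<le> signed_sum (\<lambda>u. \<sigma> u v) (S - T) B"
    using Suc.IH[of "S - T"] Suc.prems by (metis Diff_iff finite_Diff)
  have "finite U" using U Suc.prems(2) finite_subset by blast
  then obtain A where A: "A \<subseteq> T"
    and many: "card U \<le> 16 * card {v \<in> U. sqrt b / 2 \<le> signed_sum (\<lambda>u. \<sigma> u v) T A}"
    using exists_set_of_signs_good_for_many[of T U \<sigma>] T U Suc.prems(4) \<open>finite T\<close> by blast
  define U' where "U' = {v \<in> U. sqrt b / 2 \<le> signed_sum (\<lambda>u. \<sigma> u v) T A}"
  have "card W \<le> 16 ^ j * (16 * card U')"
    using U(2) many unfolding U'_def by (meson mult_le_mono2 order_trans)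
  moreover have "Suc j * sqrt b / 2 \<le> signed_sum (\<lambda>u. \<sigma> u v) S (A \<union> B)" if "v \<in> U'" for v
    using that dev_B[of v] A B T Suc.prems(1)
    by (simp add: U'_def signed_sum_union_blocks field_simps)
  moreover have "A \<union> B \<subseteq> S" "U' \<subseteq> W" using A B T U by (auto simp: U'_def)
  ultimately show ?case by (intro exI[of _ "A \<union> B"] conjI exI[of _ U']) (auto simp: mult_ac)
qed

text \<open>
  For two sides of a bipartite graph this is the surplus of edges over non-edges; on the
  diagonal, \<open>disc\<close> counts each pair of vertices twice.
\<close>

definition cross :: "('a \<Rightarrow> 'a \<Rightarrow> real) \<Rightarrow> 'a set \<Rightarrow> 'a set \<Rightarrow> real" where
  "cross \<sigma> A B = (\<Sum>u\<in>A. \<Sum>v\<in>B. \<sigma> u v)"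

abbreviation disc :: "('a \<Rightarrow> 'a \<Rightarrow> real) \<Rightarrow> 'a set \<Rightarrow> real" where
  "disc \<sigma> A \<equiv> cross \<sigma> A A"

definition sign_matrix_on :: "'a set \<Rightarrow> ('a \<Rightarrow> 'a \<Rightarrow> real) \<Rightarrow> bool" where
  "sign_matrix_on V \<sigma> \<longleftrightarrow> (\<forall>u\<in>V. \<forall>v\<in>V.
     \<sigma> u v = \<sigma> v u \<and> (if u = v then \<sigma> u v = 0 else \<bar>\<sigma> u v\<bar> = 1))"

lemma sign_matrix_on_commute: "sign_matrix_on V \<sigma> \<Longrightarrow> u \<in> V \<Longrightarrow> v \<in> V \<Longrightarrow> \<sigma> u v = \<sigma> v u"
  unfolding sign_matrix_on_def by blast

lemma sign_matrix_on_diag: "sign_matrix_on V \<sigma> \<Longrightarrow> u \<in> V \<Longrightarrow> \<sigma> u u = 0"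
  unfolding sign_matrix_on_def by metis

lemma sign_matrix_on_abs:
  "sign_matrix_on V \<sigma> \<Longrightarrow> u \<in> V \<Longrightarrow> v \<in> V \<Longrightarrow> u \<noteq> v \<Longrightarrow> \<bar>\<sigma> u v\<bar> = 1"
  unfolding sign_matrix_on_def by metis

lemma sign_matrix_on_subset: "sign_matrix_on V \<sigma> \<Longrightarrow> W \<subseteq> V \<Longrightarrow> sign_matrix_on W \<sigma>"
  unfolding sign_matrix_on_def by blast

lemma sign_matrix_on_uminus: "sign_matrix_on V (\<lambda>u v. - \<sigma> u v) \<longleftrightarrow> sign_matrix_on V \<sigma>"
  by (simp add: sign_matrix_on_def)

lemma cross_uminus: "cross (\<lambda>u v. - \<sigma> u v) A B = - cross \<sigma> A B"
  by (simp add: cross_def sum_negf)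

lemma cross_commute:
  assumes "sign_matrix_on V \<sigma>" "A \<subseteq> V" "B \<subseteq> V"
  shows "cross \<sigma> A B = cross \<sigma> B A"
proof -
  have "cross \<sigma> A B = (\<Sum>v\<in>B. \<Sum>u\<in>A. \<sigma> u v)"
    unfolding cross_def by (rule sum.swap)
  also have "\<dots> = cross \<sigma> B A"
    unfolding cross_def using assms(2,3)
    by (intro sum.cong refl sign_matrix_on_commute[OF assms(1)]) auto
  finally show ?thesis .
qed

lemma disc_Un:
  assumes "sign_matrix_on V \<sigma>" "finite V" "A \<subseteq> V" "B \<subseteq> V" "A \<inter> B = {}"
  shows "disc \<sigma> (A \<union> B) = disc \<sigma> A + disc \<sigma> B + 2 * cross \<sigma> A B"
proof -
  have fin: "finite A" "finite B" using assms(2-4) by (auto intro: finite_subset)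
  have "disc \<sigma> (A \<union> B) = disc \<sigma> A + cross \<sigma> A B + (cross \<sigma> B A + disc \<sigma> B)"
    using fin assms(5) by (simp add: cross_def sum.union_disjoint sum.distrib)
  then show ?thesis using cross_commute[OF assms(1,3,4)] by simp
qed

lemma abs_disc_le:
  assumes "sign_matrix_on V \<sigma>" "A \<subseteq> V"
  shows "\<bar>disc \<sigma> A\<bar> \<le> (real (card A))\<^sup>2"
proof -
  have "\<bar>disc \<sigma> A\<bar> \<le> (\<Sum>u\<in>A. \<Sum>v\<in>A. \<bar>\<sigma> u v\<bar>)"
    unfolding cross_def by (intro order_trans[OF sum_abs] sum_mono sum_abs)
  also have "\<dots> \<le> (\<Sum>u\<in>A. \<Sum>v\<in>A. 1)"
  proof (intro sum_mono)
    fix u v assume "u \<in> A" "v \<in> A"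
    then have "u \<in> V" "v \<in> V" using assms(2) by auto
    then show "\<bar>\<sigma> u v\<bar> \<le> 1"
      using sign_matrix_on_abs[OF assms(1)] sign_matrix_on_diag[OF assms(1)]
      by (cases "u = v") simp_all
  qed
  finally show ?thesis by (simp add: power2_eq_square)
qed

lemma sum_subset_eq_signed_sum:
  assumes "finite S" "A \<subseteq> S"
  shows "sum g A = (sum g S + signed_sum g S A) / 2"
proof -
  have "sum g S + signed_sum g S A = (\<Sum>u\<in>S. if u \<in> A then 2 * g u else 0)"
    unfolding signed_sum_def sum.distrib[symmetric] by (intro sum.cong) auto
  also have "\<dots> = 2 * sum g A"
    using assms by (simp add: sum.inter_restrict[symmetric] Int_absorb1 sum_distrib_left)
  finally show ?thesis by simp
qed

text \<open>
  A sum over \<open>A\<close> is the mean of the sum over all of \<open>S\<close> and the signed sum. When the full column sums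
  are nonnegative, the deviations of the signed sums are therefore inherited up to a factor 2.
\<close>

lemma exists_large_cross_of_nonneg_sums:
  assumes "finite S" "finite W" "card S = j * b" "16 ^ j * m \<le> card W"
    and "\<And>u v. u \<in> S \<Longrightarrow> v \<in> W \<Longrightarrow> \<bar>\<sigma> u v\<bar> = 1"
    and nonneg: "\<And>v. v \<in> W \<Longrightarrow> 0 \<le> (\<Sum>u\<in>S. \<sigma> u v)"
  shows "\<exists>A\<subseteq>S. \<exists>B\<subseteq>W. card B = m \<and> m * (j * sqrt b / 4) \<le> cross \<sigma> A B"
proof -
  obtain A U where A: "A \<subseteq> S" and U: "U \<subseteq> W" "card W \<le> 16 ^ j * card U"
    and dev: "\<And>v. v \<in> U \<Longrightarrow> j * sqrt b / 2 \<le> signed_sum (\<lambda>u. \<sigma> u v) S A"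
    using exists_set_with_large_deviations[of S W j b \<sigma>] assms by blast
  have "16 ^ j * m \<le> 16 ^ j * card U" using assms(4) U(2) by (rule order_trans)
  then have "m \<le> card U" by simp
  then obtain B where B: "B \<subseteq> U" "card B = m" using obtain_subset_with_card_n by metis
  have "m * (j * sqrt b / 4) = (\<Sum>v\<in>B. j * sqrt b / 4)" using B by simp
  also have "\<dots> \<le> (\<Sum>v\<in>B. \<Sum>u\<in>A. \<sigma> u v)"
  proof (rule sum_mono)
    fix v assume "v \<in> B"
    then have "v \<in> U" "v \<in> W" using B U by auto
    then show "j * sqrt b / 4 \<le> (\<Sum>u\<in>A. \<sigma> u v)"
      using dev[of v] nonneg[of v] sum_subset_eq_signed_sum[OF assms(1) A, of "\<lambda>u. \<sigma> u v"] by simp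
  qed
  also have "\<dots> = cross \<sigma> A B" unfolding cross_def by (rule sum.swap)
  finally show ?thesis using A B U by blast
qed

text \<open>
  One of the two signs of the column sums over \<open>S\<close> occurs for at least half of the columns; if it is
  the negative one, \<open>\<sigma>\<close> is negated.
\<close>

lemma exists_large_cross:
  assumes "sign_matrix_on V \<sigma>" "finite V" "S \<subseteq> V" "card S = j * b"
    and large: "2 * (16 ^ j * m) \<le> card (V - S)"
  shows "\<exists>A\<subseteq>S. \<exists>B\<subseteq>V - S. card B = m \<and> m * (j * sqrt b / 4) \<le> \<bar>cross \<sigma> A B\<bar>"
proof -
  define P where "P = {v \<in> V - S. 0 \<le> (\<Sum>u\<in>S. \<sigma> u v)}"
  define N where "N = {v \<in> V - S. (\<Sum>u\<in>S. \<sigma> u v) \<le> 0}"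
  have fin: "finite S" "finite P" "finite N"
    using assms(2,3) by (auto simp: P_def N_def intro: finite_subset)
  have sgn: "\<bar>\<sigma> u v\<bar> = 1" if "u \<in> S" "v \<in> V - S" for u v
    using that assms(3) by (intro sign_matrix_on_abs[OF assms(1)]) auto
  have "card (V - S) \<le> card (P \<union> N)"
    using fin by (intro card_mono) (auto simp: P_def N_def)
  also have "\<dots> \<le> card P + card N" by (rule card_Un_le)
  finally consider "16 ^ j * m \<le> card P" | "16 ^ j * m \<le> card N" using large by linarith
  then show ?thesis
  proof cases
    case 1
    have "\<exists>A\<subseteq>S. \<exists>B\<subseteq>P. card B = m \<and> m * (j * sqrt b / 4) \<le> cross \<sigma> A B"
      by (rule exists_large_cross_of_nonneg_sums[OF fin(1,2) assms(4) 1])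
        (simp_all add: P_def sgn)
    then obtain A B where AB: "A \<subseteq> S" "B \<subseteq> P" "card B = m" "m * (j * sqrt b / 4) \<le> cross \<sigma> A B"
      by blast
    have "B \<subseteq> V - S" using AB(2) by (auto simp: P_def)
    moreover have "m * (j * sqrt b / 4) \<le> \<bar>cross \<sigma> A B\<bar>" using AB(4) by linarith
    ultimately show ?thesis using AB(1,3) by blast
  next
    case 2
    have "\<exists>A\<subseteq>S. \<exists>B\<subseteq>N. card B = m \<and> m * (j * sqrt b / 4) \<le> cross (\<lambda>u v. - \<sigma> u v) A B"
      by (rule exists_large_cross_of_nonneg_sums[OF fin(1,3) assms(4) 2])
        (simp_all add: N_def sgn sum_negf)
    then obtain A B where AB: "A \<subseteq> S" "B \<subseteq> N" "card B = m"
      "m * (j * sqrt b / 4) \<le> cross (\<lambda>u v. - \<sigma> u v) A B"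
      by blast
    have "B \<subseteq> V - S" using AB(2) by (auto simp: N_def)
    moreover have "m * (j * sqrt b / 4) \<le> \<bar>cross \<sigma> A B\<bar>"
      using AB(4) unfolding cross_uminus by linarith
    ultimately show ?thesis using AB(1,3) by blast
  qed
qed

text \<open>
  The identity \<open>disc (A \<union> B) = disc A + disc B + 2 cross A B\<close> forces one of the three discrepancies to be at
  least two thirds of \<open>\<bar>cross A B\<bar>\<close>.
\<close>

lemma exists_large_disc:
  assumes "sign_matrix_on V \<sigma>" "finite V"
    and large: "j * b + 2 * (16 ^ j * m) \<le> card V"
  shows "\<exists>Y\<subseteq>V. card Y \<le> j * b + m \<and> m * (j * sqrt b / 6) \<le> \<bar>disc \<sigma> Y\<bar>"
proof -
  obtain S where S: "S \<subseteq> V" "card S = j * b"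
    using large obtain_subset_with_card_n[of "j * b" V] by auto
  have "finite S" using S assms finite_subset by blast
  then have "2 * (16 ^ j * m) \<le> card (V - S)" using S large by (simp add: card_Diff_subset)
  then obtain A B where A: "A \<subseteq> S" and B: "B \<subseteq> V - S" "card B = m"
    and AB: "m * (j * sqrt b / 4) \<le> \<bar>cross \<sigma> A B\<bar>"
    using exists_large_cross[OF assms(1,2) S] by blast
  have "finite B" using B assms finite_subset by blast
  have cards: "card A \<le> j * b" using A S \<open>finite S\<close> card_mono by metis
  have "disc \<sigma> (A \<union> B) = disc \<sigma> A + disc \<sigma> B + 2 * cross \<sigma> A B"
    using A B S by (intro disc_Un[OF assms(1,2)]) auto
  then have "2 * \<bar>cross \<sigma> A B\<bar> \<le> \<bar>disc \<sigma> A\<bar> + \<bar>disc \<sigma> B\<bar> + \<bar>disc \<sigma> (A \<union> B)\<bar>"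
    by (simp add: abs_if split: if_splits)
  then consider "m * (j * sqrt b / 6) \<le> \<bar>disc \<sigma> A\<bar>" | "m * (j * sqrt b / 6) \<le> \<bar>disc \<sigma> B\<bar>"
    | "m * (j * sqrt b / 6) \<le> \<bar>disc \<sigma> (A \<union> B)\<bar>"
    using AB by linarith
  then show ?thesis
  proof cases
    case 1 with A S cards show ?thesis by (intro exI[of _ A]) auto
  next
    case 2 with B show ?thesis by (intro exI[of _ B]) auto
  next
    case 3
    have "card (A \<union> B) \<le> j * b + m" using card_Un_le[of A B] cards B by linarith
    with 3 A B S show ?thesis by (intro exI[of _ "A \<union> B"]) auto
  qed
qed

section \<open>The skew discrepancy\<close>

text \<open>
  The penalty whose increments are the degree surpluses demanded of a set of order \<open>l\<close>; it is of order
  \<open>l powr (3/2) * sqrt (ln l)\<close>.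
\<close>

definition skew_weight :: "nat \<Rightarrow> real" where
  "skew_weight l = (\<Sum>i=1..l. sqrt ((real i - 1) * ln (real i)))"

lemma skew_weight_pred:
  assumes "l > 0"
  shows "skew_weight l - skew_weight (l - 1) = sqrt ((real l - 1) * ln (real l))"
  using assms by (cases l) (simp_all add: skew_weight_def)

lemma skew_weight_nonneg: "0 \<le> skew_weight l"
  unfolding skew_weight_def by (intro sum_nonneg) auto

lemma skew_weight_le:
  assumes "l \<le> m" "1 \<le> m"
  shows "skew_weight l \<le> real m * sqrt (real m * ln (real m))"
proof -
  have "skew_weight l \<le> (\<Sum>i=1..l. sqrt (real m * ln (real m)))"
    unfolding skew_weight_def using assms by (intro sum_mono real_sqrt_le_mono mult_mono) auto
  also have "\<dots> = real l * sqrt (real m * ln (real m))" by simp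
  also have "\<dots> \<le> real m * sqrt (real m * ln (real m))"
    using assms by (intro mult_right_mono) auto
  finally show ?thesis .
qed

text \<open>
  Half of a row sum is the surplus of a degree over \<open>(\<bar>X\<bar> - 1) / 2\<close>, hence the factor 2 on the
  left.
\<close>

definition dense :: "('a \<Rightarrow> 'a \<Rightarrow> real) \<Rightarrow> real \<Rightarrow> 'a set \<Rightarrow> bool" where
  "dense \<sigma> \<nu> X \<longleftrightarrow>
     (\<forall>x\<in>X. 2 * \<nu> * sqrt ((real (card X) - 1) * ln (real (card X))) \<le> (\<Sum>v\<in>X. \<sigma> x v))"

definition homogeneous :: "('a \<Rightarrow> 'a \<Rightarrow> real) \<Rightarrow> real \<Rightarrow> 'a set \<Rightarrow> bool" where
  "homogeneous \<sigma> \<nu> X \<longleftrightarrow> dense \<sigma> \<nu> X \<or> dense (\<lambda>u v. - \<sigma> u v) \<nu> X"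

lemma disc_remove:
  assumes "sign_matrix_on V \<sigma>" "finite V" "X \<subseteq> V" "x \<in> X"
  shows "disc \<sigma> (X - {x}) = disc \<sigma> X - 2 * (\<Sum>v\<in>X. \<sigma> x v)"
proof -
  have "finite X" using assms finite_subset by blast
  have "\<sigma> x x = 0" using sign_matrix_on_diag[OF assms(1)] assms(3,4) by auto
  have "disc \<sigma> ({x} \<union> (X - {x})) = disc \<sigma> {x} + disc \<sigma> (X - {x}) + 2 * cross \<sigma> {x} (X - {x})"
    using assms by (intro disc_Un[OF assms(1,2)]) auto
  moreover have "{x} \<union> (X - {x}) = X" using assms by auto
  moreover have "cross \<sigma> {x} (X - {x}) = (\<Sum>v\<in>X. \<sigma> x v)"
    using \<open>finite X\<close> \<open>\<sigma> x x = 0\<close> assms(4) by (simp add: cross_def sum.remove[of X x])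
  ultimately show ?thesis using \<open>\<sigma> x x = 0\<close> by (simp add: cross_def)
qed

text \<open>
  Deleting \<open>x\<close> lowers the discrepancy by twice the row sum of \<open>x\<close>. If this is never an improvement, the row
  sum is at least half the increment of the penalty.
\<close>

lemma dense_if_locally_maximal:
  assumes "sign_matrix_on V \<sigma>" "finite V" "X \<subseteq> V" "0 \<le> disc \<sigma> X"
    and max: "\<And>x. x \<in> X \<Longrightarrow> \<bar>disc \<sigma> (X - {x})\<bar> - 4 * \<nu> * skew_weight (card X - 1)
      \<le> \<bar>disc \<sigma> X\<bar> - 4 * \<nu> * skew_weight (card X)"
  shows "dense \<sigma> \<nu> X"
  unfolding dense_def
proof
  fix x assume x: "x \<in> X"
  have "finite X" using assms finite_subset by blast
  then have "card X > 0" using x by (auto simp: card_gt_0_iff)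
  have "disc \<sigma> X - 2 * (\<Sum>v\<in>X. \<sigma> x v) - 4 * \<nu> * skew_weight (card X - 1)
      \<le> disc \<sigma> X - 4 * \<nu> * skew_weight (card X)"
    using max[OF x] assms(4) disc_remove[OF assms(1-3) x] by linarith
  then have "2 * \<nu> * (skew_weight (card X) - skew_weight (card X - 1)) \<le> (\<Sum>v\<in>X. \<sigma> x v)"
    by (simp add: algebra_simps)
  then show "2 * \<nu> * sqrt ((real (card X) - 1) * ln (real (card X))) \<le> (\<Sum>v\<in>X. \<sigma> x v)"
    unfolding skew_weight_pred[OF \<open>card X > 0\<close>] .
qed

lemma small_maximiser_of_skew_disc:
  assumes "sign_matrix_on V \<sigma>" "finite V"
    and none: "\<And>X. X \<subseteq> V \<Longrightarrow> k \<le> card X \<Longrightarrow> \<not> homogeneous \<sigma> \<nu> X"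
  shows "\<exists>X\<subseteq>V. card X < k \<and> (\<forall>Y\<subseteq>V. \<bar>disc \<sigma> Y\<bar> - 4 * \<nu> * skew_weight (card Y)
    \<le> \<bar>disc \<sigma> X\<bar> - 4 * \<nu> * skew_weight (card X))"
proof -
  define D where "D Y = \<bar>disc \<sigma> Y\<bar> - 4 * \<nu> * skew_weight (card Y)" for Y
  have "finite (D ` Pow V)" "D ` Pow V \<noteq> {}" using assms(2) by auto
  then have "Max (D ` Pow V) \<in> D ` Pow V" by (rule Max_in)
  then obtain X where "X \<subseteq> V" "D X = Max (D ` Pow V)" by auto
  then have max: "D Y \<le> D X" if "Y \<subseteq> V" for Y using that assms(2) by simp
  have step: "\<bar>disc \<sigma> (X - {x})\<bar> - 4 * \<nu> * skew_weight (card X - 1)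
      \<le> \<bar>disc \<sigma> X\<bar> - 4 * \<nu> * skew_weight (card X)" if "x \<in> X" for x
  proof -
    have "finite X" using \<open>X \<subseteq> V\<close> assms(2) finite_subset by blast
    then have "card (X - {x}) = card X - 1" using that by simp
    moreover have "D (X - {x}) \<le> D X" using \<open>X \<subseteq> V\<close> by (intro max) auto
    ultimately show ?thesis by (simp add: D_def)
  qed
  have "homogeneous \<sigma> \<nu> X"
  proof (cases "0 \<le> disc \<sigma> X")
    case True
    have "dense \<sigma> \<nu> X"
      by (rule dense_if_locally_maximal[OF assms(1,2) \<open>X \<subseteq> V\<close> True step])
    then show ?thesis by (simp add: homogeneous_def)
  next
    case False
    have "dense (\<lambda>u v. - \<sigma> u v) \<nu> X"
      using assms(1) False step
      by (intro dense_if_locally_maximal[OF _ assms(2) \<open>X \<subseteq> V\<close>])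
        (simp_all add: sign_matrix_on_uminus cross_uminus)
    then show ?thesis by (simp add: homogeneous_def)
  qed
  then have "card X < k" using none[OF \<open>X \<subseteq> V\<close>] by (meson not_le)
  then show ?thesis using \<open>X \<subseteq> V\<close> max by (auto simp: D_def)
qed

text \<open>
  The maximiser of the skew discrepancy is itself homogeneous, hence has fewer than \<open>k\<close> vertices, and
  the trivial bound \<open>\<bar>disc X\<bar> \<le> \<bar>X\<bar>\<^sup>2\<close> on the maximum applies to every \<open>Y\<close>.
\<close>

lemma bound_on_disc_if_no_homogeneous:
  assumes "sign_matrix_on V \<sigma>" "finite V" "\<nu> \<ge> 0"
    and none: "\<And>X. X \<subseteq> V \<Longrightarrow> k \<le> card X \<Longrightarrow> \<not> homogeneous \<sigma> \<nu> X"
    and "Y \<subseteq> V"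
  shows "\<bar>disc \<sigma> Y\<bar> \<le> (real k)\<^sup>2 + 4 * \<nu> * skew_weight (card Y)"
proof -
  obtain X where X: "X \<subseteq> V" "card X < k"
    and "\<bar>disc \<sigma> Y\<bar> - 4 * \<nu> * skew_weight (card Y) \<le> \<bar>disc \<sigma> X\<bar> - 4 * \<nu> * skew_weight (card X)"
    using small_maximiser_of_skew_disc[OF assms(1,2) none] assms(5) by blast
  moreover have "0 \<le> 4 * \<nu> * skew_weight (card X)" using assms(3) skew_weight_nonneg by simp
  moreover have "\<bar>disc \<sigma> X\<bar> \<le> (real (card X))\<^sup>2" using assms(1) X(1) by (rule abs_disc_le)
  moreover have "(real (card X))\<^sup>2 \<le> (real k)\<^sup>2" using X by (intro power_mono) auto
  ultimately show ?thesis by linarith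
qed

section \<open>Homogeneous sets for positive surplus\<close>

text \<open>
  The choice of parameters, with \<open>x\<close> in the role of \<open>k\<close>. Blocks of size \<open>x powr (4/3)\<close> make \<open>x\<^sup>2\<close> negligible
  against the discrepancy of order \<open>(j * b) powr (3/2) * sqrt j\<close>. As \<open>16 \<le> exp 4\<close>, about
  \<open>\<delta> ln x / 8\<close> blocks cost a factor \<open>x powr (\<delta> / 2)\<close> in the number of vertices; the other half of the exponent
  \<open>\<delta>\<close> absorbs the logarithmic number of blocks. Since \<open>sqrt \<delta> = 1000 \<nu>\<close>, the gain \<open>sqrt j\<close>
  exceeds the penalty by a constant factor.
\<close>

lemma block_parameters_suffice:
  fixes x :: real
  assumes \<nu>: "\<nu> > 0" and x: "x > 1" and big: "\<nu> ^ 2 * ln x \<ge> 1"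
    and sub: "10 ^ 6 * \<nu>\<^sup>2 / 2 * ln x \<le> x powr (2/3)"
  defines "\<delta> \<equiv> 10 ^ 6 * \<nu>\<^sup>2"
  defines "j \<equiv> nat \<lfloor>\<delta> * ln x / 8\<rfloor>" and "b \<equiv> nat \<lceil>x powr (4/3)\<rceil>"
  shows "1 \<le> 2 * (j * b)"
    and "real (j * b + 2 * (16 ^ j * (j * b))) \<le> x powr (\<delta> + 4/3)"
    and "x\<^sup>2 + 4 * \<nu> * (real (2 * (j * b)) * sqrt (real (2 * (j * b)) * ln (real (2 * (j * b)))))
      < real (j * b) * (real j * sqrt (real b) / 6)"
proof -
  define L where "L = ln x"
  have L: "L > 0" using x by (simp add: L_def)
  have \<delta>: "\<delta> > 0" using \<nu> by (simp add: \<delta>_def)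
  have \<delta>L: "\<delta> * L \<ge> 1000000" using big by (simp add: \<delta>_def L_def)
  have j_le: "real j \<le> \<delta> * L / 8" and j_ge: "real j \<ge> \<delta> * L / 9" and j1: "j \<ge> 1"
  proof -
    have "real j = of_int \<lfloor>\<delta> * L / 8\<rfloor>" using \<delta>L by (simp add: j_def L_def)
    then show "real j \<le> \<delta> * L / 8" and "real j \<ge> \<delta> * L / 9"
      using \<delta>L of_int_floor_le[of "\<delta> * L / 8"] real_of_int_floor_gt_diff_one[of "\<delta> * L / 8"]
      by linarith+
    then show "j \<ge> 1" using \<delta>L by linarith
  qed
  have x43: "x powr (4/3) \<ge> 1" using x by (simp add: ge_one_powr_ge_zero)
  have b_ge: "real b \<ge> x powr (4/3)" and b_le: "real b \<le> 2 * x powr (4/3)"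
  proof -
    have "real b = of_int \<lceil>x powr (4/3)\<rceil>" using x43 by (simp add: b_def)
    then show "real b \<ge> x powr (4/3)" and "real b \<le> 2 * x powr (4/3)"
      using x43 by linarith+
  qed
  have b1: "b \<ge> 1" using b_ge x43 by linarith
  define s where "s = real j * real b"
  have s_ge: "s \<ge> x powr (4/3)"
    using mult_mono[of 1 "real j" "x powr (4/3)" "real b"] j1 b_ge unfolding s_def by simp
  have s_le: "s \<le> \<delta> * L / 4 * x powr (4/3)"
    using mult_mono[OF j_le b_le] \<delta> L unfolding s_def by (simp add: mult_ac)
  have s1: "s \<ge> 1" using s_ge x43 by linarith
  show "1 \<le> 2 * (j * b)" using j1 b1 by simp
  have pow: "(16::real) ^ j \<le> x powr (\<delta> / 2)"
  proof -
    have "(2::real) ^ 4 \<le> exp 1 ^ 4"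
      using exp_ge_add_one_self[of "1::real"] by (intro power_mono) auto
    then have "(16::real) \<le> exp 4" by (simp add: exp_of_nat_mult[symmetric])
    then have "(16::real) ^ j \<le> exp 4 ^ j" by (intro power_mono) auto
    also have "\<dots> = exp (4 * real j)" by (simp add: exp_of_nat_mult[symmetric] mult.commute)
    also have "\<dots> \<le> exp (\<delta> / 2 * L)" using j_le by simp
    also have "\<dots> = x powr (\<delta> / 2)" using x by (simp add: powr_def L_def)
    finally show ?thesis .
  qed
  show "real (j * b + 2 * (16 ^ j * (j * b))) \<le> x powr (\<delta> + 4/3)"
  proof -
    have one: "1 \<le> x powr (\<delta> / 2)" using x \<delta> by (simp add: ge_one_powr_ge_zero)
    have "real (j * b + 2 * (16 ^ j * (j * b))) = s * (1 + 2 * 16 ^ j)"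
      by (simp add: s_def algebra_simps)
    also have "\<dots> \<le> (\<delta> * L / 4 * x powr (4/3)) * (3 * x powr (\<delta> / 2))"
      using s_le s1 pow one by (intro mult_mono) auto
    also have "\<dots> = (3 / 2 * (\<delta> * L / 2)) * (x powr (4/3) * x powr (\<delta> / 2))" by simp
    also have "\<dots> \<le> exp (\<delta> * L / 2) * (x powr (4/3) * x powr (\<delta> / 2))"
    proof (intro mult_right_mono)
      \<comment> \<open>The exponential dominates \<open>3 y / 2\<close> for every \<open>y\<close>, so half of the exponent pays for the number of blocks at every \<open>x > 1\<close>.\<close>
      define y where "y = \<delta> * L / 2"
      have "0 \<le> (y - 1/2)\<^sup>2 / 2 + 7 / 8" by simp
      also have "\<dots> = 1 + y + y\<^sup>2 / 2 - 3 / 2 * y" by (simp add: power2_eq_square field_simps)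
      finally have "3 / 2 * y \<le> 1 + y + y\<^sup>2 / 2" by simp
      also have "\<dots> \<le> exp y" using \<delta> L by (intro exp_lower_Taylor_quadratic) (auto simp: y_def)
      finally show "3 / 2 * (\<delta> * L / 2) \<le> exp (\<delta> * L / 2)" by (simp add: y_def)
    qed auto
    also have "exp (\<delta> * L / 2) = x powr (\<delta> / 2)" using x by (simp add: powr_def L_def)
    also have "x powr (\<delta> / 2) * (x powr (4/3) * x powr (\<delta> / 2)) = x powr (\<delta> + 4/3)"
      by (simp add: powr_add[symmetric])
    finally show ?thesis .
  qed
  define M where "M = 2 * s"
  have "M \<le> x powr (2/3) * x powr (4/3)"
  proof -
    have "M \<le> (10 ^ 6 * \<nu>\<^sup>2 / 2 * ln x) * x powr (4/3)"
      using s_le by (simp add: M_def \<delta>_def L_def)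
    also have "\<dots> \<le> x powr (2/3) * x powr (4/3)" using sub by (intro mult_right_mono) auto
    finally show ?thesis .
  qed
  also have "\<dots> = x\<^sup>2" using x by (simp add: powr_add[symmetric] powr_numeral)
  finally have "ln M \<le> ln (x\<^sup>2)" using s1 x by (subst ln_le_cancel_iff) (auto simp: M_def)
  then have lnM: "ln M \<le> 2 * L" using x by (simp add: L_def ln_realpow)
  have x2: "x\<^sup>2 \<le> s * sqrt s"
  proof -
    have "x\<^sup>2 = x powr (4/3) * sqrt (x powr (4/3))"
      using x by (simp add: powr_half_sqrt[symmetric] powr_powr powr_add[symmetric] powr_numeral)
    also have "\<dots> \<le> s * sqrt s" using s_ge s1 by (intro mult_mono) auto
    finally show ?thesis .
  qed
  define z where "z = \<nu> * sqrt L"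
  have z: "z \<ge> 1"
  proof -
    have "1 \<le> z\<^sup>2" using big L by (simp add: z_def power_mult_distrib L_def)
    moreover have "0 \<le> z" using \<nu> L by (simp add: z_def)
    ultimately show ?thesis by (simp add: power2_nonneg_ge_1_iff)
  qed
  \<comment> \<open>The constant is \<open>sqrt \<delta> / (3 * \<nu>) = 1000 / 3\<close>, rounded down; the 3 comes from \<open>j \<ge> \<delta> * L / 9\<close>.\<close>
  have sqj: "sqrt (real j) \<ge> 333 * z"
  proof (rule real_le_rsqrt)
    have "(333 * z)\<^sup>2 = 110889 * (\<nu>\<^sup>2 * L)" using L by (simp add: z_def power_mult_distrib)
    also have "\<dots> \<le> \<delta> * L / 9" using L \<nu> by (simp add: \<delta>_def)
    finally show "(333 * z)\<^sup>2 \<le> real j" using j_ge by linarith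
  qed
  have "x\<^sup>2 + 4 * \<nu> * (M * sqrt (M * ln M)) \<le> s * sqrt s + 4 * \<nu> * (M * sqrt (M * (2 * L)))"
    using x2 \<nu> s1 lnM by (intro add_mono mult_left_mono real_sqrt_le_mono) (auto simp: M_def)
  also have "M * sqrt (M * (2 * L)) = 4 * (s * sqrt s) * sqrt L"
  proof -
    have "sqrt (M * (2 * L)) = sqrt (2\<^sup>2 * (s * L))" by (simp add: M_def)
    also have "\<dots> = 2 * (sqrt s * sqrt L)" by (simp add: real_sqrt_mult)
    finally show ?thesis by (simp add: M_def)
  qed
  also have "s * sqrt s + 4 * \<nu> * (4 * (s * sqrt s) * sqrt L) = (s * sqrt s) * (1 + 16 * z)"
    by (simp add: z_def algebra_simps)
  also have "\<dots> < (s * sqrt s) * (sqrt (real j) / 6)"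
    using sqj z s1 by (intro mult_strict_left_mono) auto
  also have "\<dots> = s * (real j * sqrt (real b) / 6)"
    by (simp add: s_def real_sqrt_mult)
  finally show "x\<^sup>2 + 4 * \<nu> * (real (2 * (j * b)) * sqrt (real (2 * (j * b)) * ln (real (2 * (j * b)))))
      < real (j * b) * (real j * sqrt (real b) / 6)"
    by (simp add: M_def s_def)
qed

lemma homogeneous_set_pos:
  assumes \<nu>: "\<nu> > 0"
  shows "\<forall>\<^sub>F k in sequentially. \<forall>(V :: 'a set) \<sigma>. finite V \<longrightarrow> sign_matrix_on V \<sigma> \<longrightarrow>
    real k powr (10 ^ 6 * \<nu>\<^sup>2 + 4/3) \<le> real (card V) \<longrightarrow>
    (\<exists>X\<subseteq>V. k \<le> card X \<and> homogeneous \<sigma> \<nu> X)"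
proof -
  have "\<forall>\<^sub>F k::nat in sequentially. \<nu>\<^sup>2 * ln (real k) \<ge> 1"
    using \<nu> by real_asymp
  moreover have "\<forall>\<^sub>F k::nat in sequentially. 10 ^ 6 * \<nu>\<^sup>2 / 2 * ln (real k) \<le> real k powr (2/3)"
    using \<nu> by real_asymp
  ultimately show ?thesis
    using eventually_gt_at_top[of 1]
  proof eventually_elim
    case (elim k)
    define j where "j = nat \<lfloor>10 ^ 6 * \<nu>\<^sup>2 * ln (real k) / 8\<rfloor>"
    define b where "b = nat \<lceil>real k powr (4/3)\<rceil>"
    note num = block_parameters_suffice[OF \<nu> _ elim(1,2), folded j_def b_def]
    have k: "1 < real k" using elim by simp
    show ?case
    proof (intro allI impI, rule ccontr)
      fix V :: "'a set" and \<sigma>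
      assume V: "finite V" "sign_matrix_on V \<sigma>"
        and card_V: "real k powr (10 ^ 6 * \<nu>\<^sup>2 + 4/3) \<le> real (card V)"
        and "\<not> (\<exists>X\<subseteq>V. k \<le> card X \<and> homogeneous \<sigma> \<nu> X)"
      then have none: "\<not> homogeneous \<sigma> \<nu> X" if "X \<subseteq> V" "k \<le> card X" for X
        using that by blast
      have "real (j * b + 2 * (16 ^ j * (j * b))) \<le> real (card V)"
        using num(2)[OF k] card_V by linarith
      then have "j * b + 2 * (16 ^ j * (j * b)) \<le> card V" by (simp only: of_nat_le_iff)
      then obtain Y where Y: "Y \<subseteq> V" "card Y \<le> j * b + j * b"
        and large: "real (j * b) * (real j * sqrt (real b) / 6) \<le> \<bar>disc \<sigma> Y\<bar>"
        using exists_large_disc[OF V(2,1)] by blast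
      have "skew_weight (card Y)
          \<le> real (2 * (j * b)) * sqrt (real (2 * (j * b)) * ln (real (2 * (j * b))))"
        using Y num(1)[OF k] by (intro skew_weight_le) auto
      then have "4 * \<nu> * skew_weight (card Y)
          \<le> 4 * \<nu> * (real (2 * (j * b)) * sqrt (real (2 * (j * b)) * ln (real (2 * (j * b)))))"
        using \<nu> by (intro mult_left_mono) auto
      moreover have "\<bar>disc \<sigma> Y\<bar> \<le> (real k)\<^sup>2 + 4 * \<nu> * skew_weight (card Y)"
        using \<nu> none Y by (intro bound_on_disc_if_no_homogeneous[OF V(2,1)]) auto
      ultimately show False using num(3)[OF k] large by linarith
    qed
  qed
qed

section \<open>Homogeneous sets for surplus zero\<close>

lemma sum_Pow_linear:
  fixes h :: "'a \<Rightarrow> real"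
  assumes "finite I"
  shows "(\<Sum>T\<in>Pow I. \<Sum>i\<in>T. h i) = 2 ^ card I / 2 * (\<Sum>i\<in>I. h i)"
  using assms
proof (induction I rule: finite_induct)
  case empty
  then show ?case by simp
next
  case (insert x I)
  have "(\<Sum>T\<in>Pow (insert x I). \<Sum>i\<in>T. h i)
      = (\<Sum>T\<in>Pow I. 2 * (\<Sum>i\<in>T. h i) + h x)"
    unfolding sum_Pow_insert[OF insert.hyps]
  proof (intro sum.cong refl)
    fix T assume "T \<in> Pow I"
    then have "finite T" "x \<notin> T" using insert.hyps finite_subset by auto
    then show "sum h T + sum h (insert x T) = 2 * sum h T + h x" by simp
  qed
  also have "\<dots> = 2 * (\<Sum>T\<in>Pow I. \<Sum>i\<in>T. h i) + 2 ^ card I * h x"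
    using insert.hyps by (simp add: sum.distrib sum_distrib_left[symmetric] card_Pow)
  finally show ?case using insert by (simp add: algebra_simps)
qed

text \<open>
  In a random subset of \<open>I\<close> each diagonal term survives with probability 1/2 and each
  off-diagonal term with probability 1/4. The excess of the diagonal is what makes unions of
  random subfamilies have large discrepancy.
\<close>

lemma sum_Pow_quadratic:
  fixes w :: "'a \<Rightarrow> 'a \<Rightarrow> real"
  assumes "finite I"
  shows "(\<Sum>T\<in>Pow I. \<Sum>i\<in>T. \<Sum>j\<in>T. w i j)
    = 2 ^ card I / 4 * ((\<Sum>i\<in>I. \<Sum>j\<in>I. w i j) + (\<Sum>i\<in>I. w i i))"
  using assms
proof (induction I rule: finite_induct)
  case empty
  then show ?case by simp
next
  case (insert x I)
  have expand: "(\<Sum>i\<in>insert x T. \<Sum>j\<in>insert x T. w i j)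
      = (\<Sum>i\<in>T. \<Sum>j\<in>T. w i j) + (\<Sum>i\<in>T. w x i + w i x) + w x x"
    if "T \<subseteq> I" for T
  proof -
    have "finite T" "x \<notin> T" using insert.hyps that finite_subset by auto
    then show ?thesis by (simp add: sum.distrib)
  qed
  have "(\<Sum>T\<in>Pow (insert x I). \<Sum>i\<in>T. \<Sum>j\<in>T. w i j)
      = (\<Sum>T\<in>Pow I. 2 * (\<Sum>i\<in>T. \<Sum>j\<in>T. w i j) + (\<Sum>i\<in>T. w x i + w i x) + w x x)"
    unfolding sum_Pow_insert[OF insert.hyps]
    by (intro sum.cong refl) (simp add: expand)
  also have "\<dots> = 2 * (\<Sum>T\<in>Pow I. \<Sum>i\<in>T. \<Sum>j\<in>T. w i j)
      + (\<Sum>T\<in>Pow I. \<Sum>i\<in>T. w x i + w i x) + 2 ^ card I * w x x"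
    using insert.hyps by (simp only: sum.distrib[of _ _ "Pow I"] sum_distrib_left[symmetric])
      (simp add: card_Pow)
  also have "\<dots> = 2 ^ card (insert x I) / 4
      * (((\<Sum>i\<in>I. \<Sum>j\<in>I. w i j) + (\<Sum>i\<in>I. w x i + w i x) + w x x)
         + ((\<Sum>i\<in>I. w i i) + w x x))"
    unfolding insert.IH sum_Pow_linear[OF insert.hyps(1)]
    using insert.hyps by (simp add: field_simps)
  also have "\<dots> = 2 ^ card (insert x I) / 4
      * ((\<Sum>i\<in>insert x I. \<Sum>j\<in>insert x I. w i j) + (\<Sum>i\<in>insert x I. w i i))"
    unfolding expand[OF subset_refl] using insert.hyps by simp
  finally show ?case .
qed

lemma disc_UNION:
  fixes X :: "'i \<Rightarrow> 'a set"
  assumes "finite I" "\<And>i. i \<in> I \<Longrightarrow> finite (X i)" "disjoint_family_on X I"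
  shows "disc \<sigma> (\<Union>i\<in>I. X i) = (\<Sum>i\<in>I. \<Sum>j\<in>I. cross \<sigma> (X i) (X j))"
proof -
  have split: "(\<Sum>v\<in>(\<Union>i\<in>I. X i). h v) = (\<Sum>i\<in>I. \<Sum>v\<in>X i. h v)" for h :: "'a \<Rightarrow> real"
    using assms by (intro sum.UNION_disjoint) (auto simp: disjoint_family_on_def)
  have "disc \<sigma> (\<Union>i\<in>I. X i) = (\<Sum>i\<in>I. \<Sum>u\<in>X i. \<Sum>j\<in>I. \<Sum>v\<in>X j. \<sigma> u v)"
    by (simp add: cross_def split)
  also have "\<dots> = (\<Sum>i\<in>I. \<Sum>j\<in>I. cross \<sigma> (X i) (X j))"
    unfolding cross_def by (intro sum.cong refl sum.swap)
  finally show ?thesis .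
qed

text \<open>
  Averaging over unions of subfamilies: no discrepancy exceeds \<open>M\<close>, hence neither does their
  average, which is a quarter of the total of the \<open>disc (X i)\<close> plus a quarter of the discrepancy of the whole union.
\<close>

lemma card_disjoint_positive_disc_le:
  assumes "finite V" "finite I" "disjoint_family_on X I" "\<And>i. i \<in> I \<Longrightarrow> X i \<subseteq> V"
    and bound: "\<And>Y. Y \<subseteq> V \<Longrightarrow> \<bar>disc \<sigma> Y\<bar> \<le> M"
    and large: "\<And>i. i \<in> I \<Longrightarrow> d \<le> disc \<sigma> (X i)"
  shows "real (card I) * d \<le> 5 * M"
proof -
  have fin: "finite (X i)" if "i \<in> I" for i
    using assms(1,4) that finite_subset by blast
  have union: "disc \<sigma> (\<Union>i\<in>T. X i) = (\<Sum>i\<in>T. \<Sum>j\<in>T. cross \<sigma> (X i) (X j))" if "T \<subseteq> I" for T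
  proof (rule disc_UNION)
    show "finite T" using that assms(2) by (rule finite_subset)
    show "disjoint_family_on X T" using that assms(3) by (rule disjoint_family_on_mono)
  qed (use that fin in auto)
  have "2 ^ card I / 4 * (disc \<sigma> (\<Union>i\<in>I. X i) + (\<Sum>i\<in>I. disc \<sigma> (X i)))
      = (\<Sum>T\<in>Pow I. disc \<sigma> (\<Union>i\<in>T. X i))"
    using sum_Pow_quadratic[OF assms(2), of "\<lambda>i j. cross \<sigma> (X i) (X j)"] by (simp add: union)
  also have "\<dots> \<le> (\<Sum>T\<in>Pow I. M)"
  proof (rule sum_mono)
    fix T assume "T \<in> Pow I"
    then have "\<bar>disc \<sigma> (\<Union>i\<in>T. X i)\<bar> \<le> M" using assms(4) by (intro bound) auto
    then show "disc \<sigma> (\<Union>i\<in>T. X i) \<le> M" by linarith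
  qed
  also have "\<dots> = 2 ^ card I / 4 * (4 * M)" using assms(2) by (simp add: card_Pow)
  finally have "disc \<sigma> (\<Union>i\<in>I. X i) + (\<Sum>i\<in>I. disc \<sigma> (X i)) \<le> 4 * M"
    by (rule mult_left_le_imp_le) simp
  moreover have "\<bar>disc \<sigma> (\<Union>i\<in>I. X i)\<bar> \<le> M" using assms(4) by (intro bound) auto
  moreover have "real (card I) * d \<le> (\<Sum>i\<in>I. disc \<sigma> (X i))"
    using large by (intro sum_bounded_below) auto
  ultimately show ?thesis by linarith
qed

lemma card_disjoint_large_disc_le:
  assumes "finite V" "finite I" "disjoint_family_on X I" "\<And>i. i \<in> I \<Longrightarrow> X i \<subseteq> V"
    and bound: "\<And>Y. Y \<subseteq> V \<Longrightarrow> \<bar>disc \<sigma> Y\<bar> \<le> M"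
    and "0 \<le> d" and large: "\<And>i. i \<in> I \<Longrightarrow> d \<le> \<bar>disc \<sigma> (X i)\<bar>"
  shows "real (card I) * d \<le> 10 * M"
proof -
  define P where "P = {i \<in> I. d \<le> disc \<sigma> (X i)}"
  define N where "N = {i \<in> I. d \<le> - disc \<sigma> (X i)}"
  have "P \<subseteq> I" "N \<subseteq> I" by (auto simp: P_def N_def)
  have "I \<subseteq> P \<union> N"
  proof
    fix i assume "i \<in> I"
    then show "i \<in> P \<union> N" using large[of i] by (auto simp: P_def N_def abs_if split: if_splits)
  qed
  then have "card I \<le> card (P \<union> N)"
    using \<open>P \<subseteq> I\<close> \<open>N \<subseteq> I\<close> assms(2) by (intro card_mono) (auto intro: finite_subset)
  also have "\<dots> \<le> card P + card N" by (rule card_Un_le)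
  finally have "real (card I) * d \<le> (real (card P) + real (card N)) * d"
    using \<open>0 \<le> d\<close> by (intro mult_right_mono) auto
  moreover have "real (card P) * d \<le> 5 * M"
    using \<open>P \<subseteq> I\<close> assms bound
    by (intro card_disjoint_positive_disc_le[where V = V and \<sigma> = \<sigma> and X = X])
      (auto simp: P_def intro: finite_subset disjoint_family_on_mono)
  moreover have "real (card N) * d \<le> 5 * M"
    using \<open>N \<subseteq> I\<close> assms bound
    by (intro card_disjoint_positive_disc_le[where V = V and \<sigma> = "\<lambda>u v. - \<sigma> u v" and X = X])
      (auto simp: N_def cross_uminus intro: finite_subset disjoint_family_on_mono)
  ultimately show ?thesis by (simp add: algebra_simps)
qed

text \<open>
  As long as at most half of the vertices have been used, the remaining ones contain a set of
  large discrepancy, and the maximiser of \<open>\<bar>disc\<bar>\<close> among them is homogeneous, hence small.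
\<close>

lemma disjoint_small_sets_of_large_disc:
  fixes V :: "'a set"
  assumes "sign_matrix_on V \<sigma>" "finite V"
    and none: "\<And>X. X \<subseteq> V \<Longrightarrow> k \<le> card X \<Longrightarrow> \<not> homogeneous \<sigma> 0 X"
    and large: "\<And>W. W \<subseteq> V \<Longrightarrow> card V \<le> 2 * card W \<Longrightarrow> \<exists>Y\<subseteq>W. d \<le> \<bar>disc \<sigma> Y\<bar>"
    and "2 * (r * k) \<le> card V"
  shows "\<exists>X :: nat \<Rightarrow> 'a set. disjoint_family_on X {..<r} \<and>
    (\<forall>i<r. X i \<subseteq> V \<and> card (X i) < k \<and> d \<le> \<bar>disc \<sigma> (X i)\<bar>)"
  using assms(5)
proof (induction r)
  case 0
  then show ?case by (simp add: disjoint_family_on_def)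
next
  case (Suc r)
  then obtain X :: "nat \<Rightarrow> 'a set" where disj: "disjoint_family_on X {..<r}"
    and X: "\<And>i. i < r \<Longrightarrow> X i \<subseteq> V \<and> card (X i) < k \<and> d \<le> \<bar>disc \<sigma> (X i)\<bar>"
    by auto
  define U where "U = (\<Union>i<r. X i)"
  define W where "W = V - U"
  have "W \<subseteq> V" by (auto simp: W_def)
  have "U \<subseteq> V" using X by (auto simp: U_def)
  have "card U \<le> (\<Sum>i<r. card (X i))" unfolding U_def by (rule card_UN_le) simp
  also have "\<dots> \<le> r * k" using sum_bounded_above[of "{..<r}" "\<lambda>i. card (X i)" k] X by fastforce
  finally have "card U \<le> r * k" .
  moreover have "card W = card V - card U"
    using \<open>U \<subseteq> V\<close> assms(2) finite_subset unfolding W_def by (intro card_Diff_subset) auto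
  ultimately have "card V \<le> 2 * card W" using Suc.prems by (simp add: algebra_simps)
  then obtain Y where Y: "Y \<subseteq> W" "d \<le> \<bar>disc \<sigma> Y\<bar>" using large[OF \<open>W \<subseteq> V\<close>] by blast
  have none_W: "\<not> homogeneous \<sigma> 0 Z" if "Z \<subseteq> W" "k \<le> card Z" for Z
    using none[of Z] that \<open>W \<subseteq> V\<close> by blast
  obtain Z where Z: "Z \<subseteq> W" "card Z < k"
    and max: "\<forall>Y\<subseteq>W. \<bar>disc \<sigma> Y\<bar> - 4 * 0 * skew_weight (card Y)
      \<le> \<bar>disc \<sigma> Z\<bar> - 4 * 0 * skew_weight (card Z)"
    using small_maximiser_of_skew_disc[OF sign_matrix_on_subset[OF assms(1) \<open>W \<subseteq> V\<close>]
        finite_subset[OF \<open>W \<subseteq> V\<close> assms(2)] none_W] by blast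
  have "d \<le> \<bar>disc \<sigma> Z\<bar>" using max[rule_format, OF Y(1)] Y(2) by simp
  have "disjoint_family_on (X(r := Z)) {..<Suc r}"
    unfolding disjoint_family_on_def
  proof (intro ballI impI)
    fix m n assume mn: "m \<in> {..<Suc r}" "n \<in> {..<Suc r}" "m \<noteq> n"
    have "X i \<inter> Z = {}" if "i < r" for i using that Z(1) by (auto simp: W_def U_def)
    moreover have "X m \<inter> X n = {}" if "m < r" "n < r"
      using that disj mn(3) by (auto simp: disjoint_family_on_def)
    ultimately show "(X(r := Z)) m \<inter> (X(r := Z)) n = {}" using mn by (auto simp: less_Suc_eq)
  qed
  moreover have "\<forall>i<Suc r. (X(r := Z)) i \<subseteq> V \<and> card ((X(r := Z)) i) < k \<and> d \<le> \<bar>disc \<sigma> ((X(r := Z)) i)\<bar>"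
    using X Z \<open>d \<le> \<bar>disc \<sigma> Z\<bar>\<close> \<open>W \<subseteq> V\<close> by (auto simp: less_Suc_eq)
  ultimately show ?case by blast
qed

text \<open>
  Every half of the vertex set contains a set with discrepancy at least \<open>k\<^sup>2 / 3417\<close>. Without a homogeneous set on at
  least \<open>k\<close> vertices, no discrepancy exceeds \<open>k\<^sup>2\<close>. Then by \<open>card_disjoint_large_disc_le\<close> at most 34170 disjoint sets can have discrepancy that large, but \<open>k powr (4/3)\<close>
  vertices leave room for about \<open>k powr (1/3) / 2\<close> of them.
\<close>

lemma homogeneous_set_zero:
  assumes "finite V" "sign_matrix_on V \<sigma>"
    and k: "10 ^ 15 \<le> k" and card_V: "real k powr (4/3) \<le> real (card V)"
  shows "\<exists>X\<subseteq>V. k \<le> card X \<and> homogeneous \<sigma> 0 X"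
proof (rule ccontr)
  assume "\<not> ?thesis"
  then have none: "\<not> homogeneous \<sigma> 0 X" if "X \<subseteq> V" "k \<le> card X" for X
    using that by blast
  define x where "x = real k"
  define d where "d = x\<^sup>2 / 3417"
  have x: "x \<ge> 10 ^ 15" using k unfolding x_def by (metis of_nat_le_iff of_nat_numeral of_nat_power)
  then have x1: "1 \<le> x" by simp
  have x43: "x powr (4/3) = x * x powr (1/3)"
    using x by (simp add: powr_mult_base)
  have "(10 ^ 15) powr (1/3) \<le> x powr (1/3)" using x by (intro powr_mono2) auto
  moreover have "(10 ^ 15 :: real) powr (1/3) = 100000"
  proof -
    have "(10 ^ 15 :: real) = 10 powr 15" by simp
    then have "(10 ^ 15 :: real) powr (1/3) = 10 powr 5" by (simp only: powr_powr) simp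
    then show ?thesis by simp
  qed
  ultimately have root: "100000 \<le> x powr (1/3)" by simp
  have n_ge: "100000 * x \<le> real (card V)"
    using card_V mult_left_mono[OF root, of x] x unfolding x_def[symmetric] x43 by linarith
  have large: "\<exists>Y\<subseteq>W. d \<le> \<bar>disc \<sigma> Y\<bar>" if W: "W \<subseteq> V" "card V \<le> 2 * card W" for W
  proof -
    \<comment> \<open>A single block of size \<open>s\<close> uses \<open>s + 2 * 16 * s = 33 * s\<close> vertices.\<close>
    define s where "s = card W div 33"
    have block: "1 * s + 2 * (16 ^ 1 * s) \<le> card W" by (simp add: s_def)
    obtain Y where "Y \<subseteq> W" and Y: "real s * (real 1 * sqrt (real s) / 6) \<le> \<bar>disc \<sigma> Y\<bar>"
      using exists_large_disc[OF sign_matrix_on_subset[OF assms(2) W(1)]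
        finite_subset[OF W(1) assms(1)] block] by auto
    have "card W < 33 * (s + 1)"
      using dividend_less_times_div[of 33 "card W"] by (simp add: s_def)
    then have "card V \<le> 66 * (s + 1)" using W(2) by linarith
    then have "real (card V) \<le> real (66 * (s + 1))" by (simp only: of_nat_le_iff)
    then have "real (card V) \<le> 66 * real s + 66" by simp
    then have s_ge: "x powr (4/3) / 67 \<le> real s"
      using card_V n_ge x1 unfolding x_def[symmetric] by linarith
    \<comment> \<open>The constant is \<open>3417 = 67 * (17/2) * 6\<close>, where \<open>17/2\<close> is a rational upper bound for \<open>sqrt 67\<close>.\<close>
    have "(x powr (2/3) / (17/2))\<^sup>2 = x powr (4/3) / (289/4)"
      using x by (simp add: power_divide power2_eq_square powr_add[symmetric])
    also have "\<dots> \<le> real s" using s_ge by (simp add: field_simps)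
    finally have sqrt_ge: "x powr (2/3) / (17/2) \<le> sqrt (real s)" by (rule real_le_rsqrt)
    have "x\<^sup>2 = x powr (4/3) * x powr (2/3)"
      using x by (simp add: powr_add[symmetric] powr_numeral)
    then have "d = (x powr (4/3) / 67) * (x powr (2/3) / (17/2)) / 6" by (simp add: d_def)
    also have "\<dots> \<le> real s * sqrt (real s) / 6"
      using s_ge sqrt_ge by (intro divide_right_mono mult_mono) auto
    also have "\<dots> \<le> \<bar>disc \<sigma> Y\<bar>" using Y by simp
    finally show ?thesis using \<open>Y \<subseteq> W\<close> by blast
  qed
  have "real (2 * (35000 * k)) \<le> real (card V)" using n_ge x by (simp add: x_def)
  then have "2 * (35000 * k) \<le> card V" by (simp only: of_nat_le_iff)
  then obtain X :: "nat \<Rightarrow> 'a set" where disj: "disjoint_family_on X {..<35000}"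
    and X: "\<And>i. i < 35000 \<Longrightarrow> X i \<subseteq> V \<and> card (X i) < k \<and> d \<le> \<bar>disc \<sigma> (X i)\<bar>"
    using disjoint_small_sets_of_large_disc[OF assms(2,1) none large] by blast
  have bound: "\<bar>disc \<sigma> Y\<bar> \<le> x\<^sup>2" if "Y \<subseteq> V" for Y
    using bound_on_disc_if_no_homogeneous[OF assms(2,1) order_refl none that] by (simp add: x_def)
  have "real (card {..<35000::nat}) * d \<le> 10 * x\<^sup>2"
    by (rule card_disjoint_large_disc_le[OF assms(1) _ disj _ bound])
      (use X in \<open>auto simp: d_def\<close>)
  then have "35000 / 3417 * x\<^sup>2 \<le> 10 * x\<^sup>2" by (simp add: d_def)
  moreover have "0 < x\<^sup>2" using x by simp
  ultimately show False by linarith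
qed

section \<open>From graphs to sign matrices\<close>

definition sign_of :: "'a pair_pre_digraph \<Rightarrow> 'a \<Rightarrow> 'a \<Rightarrow> real" where
  "sign_of G u v = (if u = v then 0 else if (u, v) \<in> parcs G then 1 else -1)"

lemma sign_matrix_on_sign_of:
  assumes "pair_graph G"
  shows "sign_matrix_on (pverts G) (sign_of G)"
proof -
  interpret pair_graph G by fact
  have "(u, v) \<in> parcs G \<longleftrightarrow> (v, u) \<in> parcs G" for u v
    using arcs_symmetric by blast
  then show ?thesis unfolding sign_matrix_on_def sign_of_def by simp
qed

lemma sign_of_complement:
  assumes "u \<in> pverts G" "v \<in> pverts G"
  shows "sign_of (complement G) u v = - sign_of G u v"
  using assms by (auto simp: sign_of_def complement_def)

lemma out_degree_induced:
  assumes G: "pair_graph G" and H: "induced_subgraph (with_proj H) (with_proj G)"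
    and x: "x \<in> pverts H"
  shows "2 * real (out_degree (with_proj H) x)
    = real (card (pverts H)) - 1 + (\<Sum>v\<in>pverts H. sign_of G x v)"
proof -
  interpret pair_graph G by fact
  have sub: "pverts H \<subseteq> pverts G"
    and arcs: "parcs H = {e \<in> parcs G. fst e \<in> pverts H \<and> snd e \<in> pverts H}"
    using H by (auto simp: induced_subgraph_def subgraph_def)
  have fin: "finite (pverts H)" using sub finite_verts by (rule finite_subset)
  define N where "N = {v \<in> pverts H. (x, v) \<in> parcs G}"
  have "x \<notin> N" using no_loops' by (auto simp: N_def)
  have N: "finite N" "N \<subseteq> pverts H" using fin by (auto simp: N_def)
  have "out_arcs (with_proj H) x = Pair x ` N"
    using x by (auto simp: out_arcs_def arcs N_def)
  then have deg: "out_degree (with_proj H) x = card N"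
    by (simp add: out_degree_def card_image inj_on_def)
  have "(\<Sum>v\<in>pverts H. sign_of G x v) = (\<Sum>v\<in>pverts H - {x}. sign_of G x v)"
    using fin x by (simp add: sum.remove[of "pverts H" x] sign_of_def)
  also have "\<dots> = (\<Sum>v\<in>pverts H - {x}. 2 * of_bool (v \<in> N) - 1)"
    by (intro sum.cong) (auto simp: sign_of_def N_def)
  also have "\<dots> = 2 * real (card N) - (real (card (pverts H)) - 1)"
  proof -
    have "(pverts H - {x}) \<inter> N = N" using N \<open>x \<notin> N\<close> by auto
    moreover have "card (pverts H) > 0" using fin x by (auto simp: card_gt_0_iff)
    ultimately show ?thesis
      using fin x by (simp add: sum_subtractf sum_distrib_left[symmetric] of_nat_diff)
  qed
  finally show ?thesis using deg by simp
qed

lemma induced_subgraph_on: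
  assumes "pair_graph G" "X \<subseteq> pverts G"
  shows "induced_subgraph
    (with_proj \<lparr>pverts = X, parcs = {e \<in> parcs G. fst e \<in> X \<and> snd e \<in> X}\<rparr>) (with_proj G)"
proof -
  interpret pair_graph G by fact
  show ?thesis
    using assms(2)
    by (auto simp: induced_subgraph_def subgraph_def compatible_def wf_digraph_def
        dest: in_arcsD1 in_arcsD2)
qed

lemma exists_induced_subgraph_if_dense:
  assumes G: "pair_graph G" and X: "X \<subseteq> pverts G" "X \<noteq> {}"
    and dense: "dense (sign_of G) \<nu> X"
  shows "\<exists>H. induced_subgraph (with_proj H) (with_proj G) \<and> pverts H = X \<and>
    1/2 * (real (card X) - 1) + \<nu> * sqrt ((real (card X) - 1) * ln (real (card X)))
      \<le> real (min_degree H)"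
proof -
  interpret pair_graph G by fact
  define H where "H = \<lparr>pverts = X, parcs = {e \<in> parcs G. fst e \<in> X \<and> snd e \<in> X}\<rparr>"
  have H: "induced_subgraph (with_proj H) (with_proj G)"
    unfolding H_def by (rule induced_subgraph_on[OF G X(1)])
  have [simp]: "pverts H = X" by (simp add: H_def)
  have "finite X" using X(1) finite_verts by (rule finite_subset)
  then have "min_degree H \<in> out_degree (with_proj H) ` X"
    unfolding min_degree_def using X by (simp add: Min_in)
  then obtain x where x: "x \<in> X" "min_degree H = out_degree (with_proj H) x" by auto
  have "2 * real (min_degree H) = real (card X) - 1 + (\<Sum>v\<in>X. sign_of G x v)"
    using out_degree_induced[OF G H, of x] x by simp
  moreover have "2 * (\<nu> * sqrt ((real (card X) - 1) * ln (real (card X)))) \<le> (\<Sum>v\<in>X. sign_of G x v)"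
    using dense x(1) by (simp add: dense_def mult.assoc)
  moreover have "1/2 * (c - 1) + r \<le> d" if "2 * d = c - 1 + t" "2 * r \<le> t" for c d r t :: real
    using that by (simp add: field_simps)
  ultimately have "1/2 * (real (card X) - 1) + \<nu> * sqrt ((real (card X) - 1) * ln (real (card X)))
      \<le> real (min_degree H)"
    by blast
  then show ?thesis using H by (intro exI[of _ H]) simp
qed

lemma dense_cong:
  assumes "\<And>u v. u \<in> X \<Longrightarrow> v \<in> X \<Longrightarrow> \<sigma> u v = \<tau> u v"
  shows "dense \<sigma> \<nu> X \<longleftrightarrow> dense \<tau> \<nu> X"
  using assms by (simp add: dense_def)

lemma exists_induced_subgraph_if_homogeneous:
  assumes G: "pair_graph G" and X: "X \<subseteq> pverts G" "X \<noteq> {}"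
    and "homogeneous (sign_of G) \<nu> X"
  shows "\<exists>H. (induced_subgraph (with_proj H) (with_proj G) \<or>
      induced_subgraph (with_proj H) (with_proj (complement G))) \<and> pverts H = X \<and>
    1/2 * (real (card X) - 1) + \<nu> * sqrt ((real (card X) - 1) * ln (real (card X)))
      \<le> real (min_degree H)"
  using assms(4) unfolding homogeneous_def
proof
  assume "dense (sign_of G) \<nu> X"
  from exists_induced_subgraph_if_dense[OF G X this] show ?thesis by blast
next
  assume "dense (\<lambda>u v. - sign_of G u v) \<nu> X"
  moreover have "- sign_of G u v = sign_of (complement G) u v" if "u \<in> X" "v \<in> X" for u v
    using that X(1) by (subst sign_of_complement) auto
  ultimately have "dense (sign_of (complement G)) \<nu> X"
    using dense_cong[of X "\<lambda>u v. - sign_of G u v" "sign_of (complement G)" \<nu>] by blast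
  moreover have "X \<subseteq> pverts (complement G)" using X by (simp add: complement_def)
  ultimately show ?thesis
    using exists_induced_subgraph_if_dense[OF pair_graph_complement[OF G] _ X(2)] by blast
qed

lemma quasi_Ramsey_upper_bound:
  fixes \<nu> c :: real
  assumes "\<nu> \<ge> 0" "c > 4/3"
  shows "\<forall>\<^sub>F k::nat in sequentially. \<forall>G :: 'a pair_pre_digraph. pair_graph G \<longrightarrow>
    real k powr (c * 10^6 * \<nu>\<^sup>2 + 4/3) \<le> real (card (pverts G)) \<longrightarrow>
    (\<exists>(H :: 'a pair_pre_digraph) l.
      (induced_subgraph (with_proj H) (with_proj G) \<or>
       induced_subgraph (with_proj H) (with_proj (complement G))) \<and>
      card (pverts H) = l \<and> l \<ge> k \<and>
      1/2 * (real l - 1) + \<nu> * sqrt ((real l - 1) * ln (real l)) \<le> real (min_degree H))"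
proof -
  have "\<forall>\<^sub>F k in sequentially. \<forall>(V :: 'a set) \<sigma>. finite V \<longrightarrow> sign_matrix_on V \<sigma> \<longrightarrow>
    real k powr (10 ^ 6 * \<nu>\<^sup>2 + 4/3) \<le> real (card V) \<longrightarrow>
    (\<exists>X\<subseteq>V. k \<le> card X \<and> homogeneous \<sigma> \<nu> X)"
  proof (cases "\<nu> = 0")
    case True
    have "\<exists>X\<subseteq>V. k \<le> card X \<and> homogeneous \<sigma> 0 X"
      if "10 ^ 15 \<le> k" "finite V" "sign_matrix_on V \<sigma>" "real k powr (4/3) \<le> real (card V)"
      for k and V :: "'a set" and \<sigma>
      using that by (intro homogeneous_set_zero) auto
    then show ?thesis unfolding True by (auto intro!: eventually_sequentiallyI[of "10 ^ 15"])
  next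
    case False
    then show ?thesis using assms by (intro homogeneous_set_pos) auto
  qed
  then show ?thesis
    using eventually_ge_at_top[of 1]
  proof eventually_elim
    case (elim k)
    show ?case
    proof (intro allI impI)
      fix G :: "'a pair_pre_digraph"
      assume G: "pair_graph G"
        and large: "real k powr (c * 10^6 * \<nu>\<^sup>2 + 4/3) \<le> real (card (pverts G))"
      interpret pair_graph G by fact
      have "1 * (10 ^ 6 * \<nu>\<^sup>2) \<le> c * (10 ^ 6 * \<nu>\<^sup>2)" using assms(2) by (intro mult_right_mono) auto
      then have "real k powr (10 ^ 6 * \<nu>\<^sup>2 + 4/3) \<le> real k powr (c * 10^6 * \<nu>\<^sup>2 + 4/3)"
        using elim(2) by (intro powr_mono) auto
      then obtain X where X: "X \<subseteq> pverts G" "k \<le> card X" "homogeneous (sign_of G) \<nu> X"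
        using elim(1) large sign_matrix_on_sign_of[OF G] finite_verts by (meson order_trans)
      then have "X \<noteq> {}" using elim(2) by auto
      from exists_induced_subgraph_if_homogeneous[OF G X(1) this X(3)] X(2)
      show "\<exists>H l. (induced_subgraph (with_proj H) (with_proj G) \<or>
          induced_subgraph (with_proj H) (with_proj (complement G))) \<and>
        card (pverts H) = l \<and> l \<ge> k \<and>
        1/2 * (real l - 1) + \<nu> * sqrt ((real l - 1) * ln (real l)) \<le> real (min_degree H)"
        by blast
    qed
  qed
qed

section \<open>Chernoff bound and union bound\<close>

text \<open>
  This is \<open>cosh a \<le> exp (a\<^sup>2 / 2)\<close>: for \<open>a \<ge> 0\<close> the derivative of \<open>exp (- (a\<^sup>2 / 2)) * cosh a\<close> has the sign of
  \<open>sinh a - a * cosh a\<close>, which vanishes at 0 and is decreasing.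
\<close>

lemma exp_add_exp_minus_le: "exp a + exp (- a) \<le> 2 * exp (a\<^sup>2 / 2)" for a :: real
proof -
  have sinh_le: "sinh x \<le> x * cosh x" if "0 \<le> x" for x :: real
  proof -
    have "(\<lambda>x::real. x * cosh x - sinh x) 0 \<le> (\<lambda>x. x * cosh x - sinh x) x"
    proof (rule DERIV_nonneg_imp_nondecreasing[OF that])
      fix y :: real assume "0 \<le> y" "y \<le> x"
      have "((\<lambda>x. x * cosh x - sinh x) has_real_derivative y * sinh y) (at y)"
        by (auto intro!: derivative_eq_intros)
      moreover have "0 \<le> y * sinh y" using \<open>0 \<le> y\<close> by simp
      ultimately show "\<exists>d. ((\<lambda>x. x * cosh x - sinh x) has_real_derivative d) (at y) \<and> 0 \<le> d"
        by blast
    qed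
    then show ?thesis by simp
  qed
  have cosh_le: "cosh x \<le> exp (x\<^sup>2 / 2)" if "0 \<le> x" for x :: real
  proof -
    have "(\<lambda>x::real. exp (- (x\<^sup>2 / 2)) * cosh x) x \<le> (\<lambda>x. exp (- (x\<^sup>2 / 2)) * cosh x) 0"
    proof (rule DERIV_nonpos_imp_nonincreasing[OF that])
      fix y :: real assume "0 \<le> y" "y \<le> x"
      have "((\<lambda>x. exp (- (x\<^sup>2 / 2)) * cosh x) has_real_derivative
          exp (- (y\<^sup>2 / 2)) * (sinh y - y * cosh y)) (at y)"
        by (auto intro!: derivative_eq_intros simp: algebra_simps)
      moreover have "exp (- (y\<^sup>2 / 2)) * (sinh y - y * cosh y) \<le> 0"
        using sinh_le[OF \<open>0 \<le> y\<close>] by (simp add: mult_nonneg_nonpos)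
      ultimately show "\<exists>d. ((\<lambda>x. exp (- (x\<^sup>2 / 2)) * cosh x) has_real_derivative d) (at y) \<and> d \<le> 0"
        by blast
    qed
    then have "cosh x * exp (- (x\<^sup>2 / 2)) \<le> 1" by (simp add: mult.commute)
    then show ?thesis by (simp add: exp_minus field_simps)
  qed
  have "cosh a \<le> exp (a\<^sup>2 / 2)" using cosh_le[of a] cosh_le[of "- a"] by (cases "0 \<le> a") simp_all
  then show ?thesis by (simp add: cosh_def)
qed

lemma sum_exp_signed_sum:
  assumes "finite S"
  shows "(\<Sum>A\<in>Pow S. exp (signed_sum g S A)) = (\<Prod>u\<in>S. exp (g u) + exp (- g u))"
  using assms
proof (induction S rule: finite_induct)
  case empty
  then show ?case by (simp add: signed_sum_def)
next
  case (insert x S)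
  have "(\<Sum>A\<in>Pow (insert x S). exp (signed_sum g (insert x S) A))
      = (\<Sum>A\<in>Pow S. exp (signed_sum g S A) * (exp (g x) + exp (- g x)))"
    unfolding sum_Pow_insert[OF insert.hyps]
    by (intro sum.cong)
      (auto simp: signed_sum_insert insert.hyps exp_add exp_diff exp_minus field_simps)
  then show ?case using insert by (simp add: sum_distrib_right[symmetric])
qed

text \<open>
  Markov's inequality for \<open>exp (c * signed_sum g S A)\<close> with the optimal \<open>c\<close>, counting subsets instead of
  measuring probabilities.
\<close>

lemma signed_sum_Chernoff:
  assumes "finite S" "0 \<le> t" and pos: "0 < (\<Sum>u\<in>S. (g u)\<^sup>2)"
  shows "real (card {A \<in> Pow S. t \<le> signed_sum g S A})
    \<le> 2 ^ card S * exp (- (t\<^sup>2 / (2 * (\<Sum>u\<in>S. (g u)\<^sup>2))))"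
proof -
  define s where "s = (\<Sum>u\<in>S. (g u)\<^sup>2)"
  define c where "c = t / s"
  have s: "s > 0" using pos by (simp add: s_def)
  have scale: "signed_sum (\<lambda>u. c * g u) S A = c * signed_sum g S A" for A
    unfolding signed_sum_def sum_distrib_left by (intro sum.cong) auto
  have "real (card {A \<in> Pow S. t \<le> signed_sum g S A}) * exp (c * t)
      = (\<Sum>A\<in>{A \<in> Pow S. t \<le> signed_sum g S A}. exp (c * t))" by simp
  also have "\<dots> \<le> (\<Sum>A\<in>{A \<in> Pow S. t \<le> signed_sum g S A}. exp (c * signed_sum g S A))"
    using s assms(2) by (intro sum_mono) (auto simp: c_def intro!: divide_right_mono mult_left_mono)
  also have "\<dots> \<le> (\<Sum>A\<in>Pow S. exp (c * signed_sum g S A))"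
    using assms(1) by (intro sum_mono2) auto
  also have "\<dots> = (\<Prod>u\<in>S. exp (c * g u) + exp (- (c * g u)))"
    unfolding scale[symmetric] by (rule sum_exp_signed_sum[OF assms(1)])
  also have "\<dots> \<le> (\<Prod>u\<in>S. 2 * exp ((c * g u)\<^sup>2 / 2))"
    by (intro prod_mono conjI exp_add_exp_minus_le add_nonneg_nonneg) auto
  also have "\<dots> = 2 ^ card S * exp (\<Sum>u\<in>S. (c * g u)\<^sup>2 / 2)"
    using assms(1) by (simp add: prod.distrib exp_sum)
  also have "(\<Sum>u\<in>S. (c * g u)\<^sup>2 / 2) = c\<^sup>2 * s / 2"
    by (simp add: s_def power_mult_distrib sum_distrib_left sum_divide_distrib)
  finally have "real (card {A \<in> Pow S. t \<le> signed_sum g S A})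
      \<le> 2 ^ card S * exp (c\<^sup>2 * s / 2) / exp (c * t)"
    by (simp add: pos_le_divide_eq)
  also have "\<dots> = 2 ^ card S * exp (c\<^sup>2 * s / 2 - c * t)" by (simp add: exp_diff)
  also have "c\<^sup>2 * s / 2 - c * t = - (t\<^sup>2 / (2 * s))"
    using s by (simp add: c_def power2_eq_square field_simps)
  finally show ?thesis by (simp add: s_def)
qed

lemma signed_sum_Chernoff_abs:
  assumes "finite S" "0 \<le> t" and pos: "0 < (\<Sum>u\<in>S. (g u)\<^sup>2)"
  shows "real (card {A \<in> Pow S. t \<le> \<bar>signed_sum g S A\<bar>})
    \<le> 2 * 2 ^ card S * exp (- (t\<^sup>2 / (2 * (\<Sum>u\<in>S. (g u)\<^sup>2))))"
proof -
  define upper where "upper h = {A \<in> Pow S. t \<le> signed_sum h S A}" for h :: "'a \<Rightarrow> real"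
  have neg: "signed_sum (\<lambda>u. - g u) S A = - signed_sum g S A" for A
    unfolding signed_sum_def sum_negf[symmetric] by (intro sum.cong) auto
  have "{A \<in> Pow S. t \<le> \<bar>signed_sum g S A\<bar>} \<subseteq> upper g \<union> upper (\<lambda>u. - g u)"
    by (auto simp: upper_def neg)
  then have "card {A \<in> Pow S. t \<le> \<bar>signed_sum g S A\<bar>} \<le> card (upper g \<union> upper (\<lambda>u. - g u))"
    using assms(1) by (intro card_mono) (auto simp: upper_def)
  also have "\<dots> \<le> card (upper g) + card (upper (\<lambda>u. - g u))" by (rule card_Un_le)
  finally have "real (card {A \<in> Pow S. t \<le> \<bar>signed_sum g S A\<bar>})
      \<le> real (card (upper g)) + real (card (upper (\<lambda>u. - g u)))" by linarith
  moreover have "real (card (upper g)) \<le> 2 ^ card S * exp (- (t\<^sup>2 / (2 * (\<Sum>u\<in>S. (g u)\<^sup>2))))"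
    unfolding upper_def by (rule signed_sum_Chernoff[OF assms])
  moreover have "real (card (upper (\<lambda>u. - g u))) \<le> 2 ^ card S * exp (- (t\<^sup>2 / (2 * (\<Sum>u\<in>S. (g u)\<^sup>2))))"
    using signed_sum_Chernoff[of S t "\<lambda>u. - g u"] assms by (simp add: upper_def)
  ultimately show ?thesis by linarith
qed

lemma sum_Pow_power_card:
  fixes z :: real
  assumes "finite V"
  shows "(\<Sum>X\<in>Pow V. z ^ card X) = (1 + z) ^ card V"
  using assms
proof (induction V rule: finite_induct)
  case empty
  then show ?case by simp
next
  case (insert x V)
  have "(\<Sum>X\<in>Pow (insert x V). z ^ card X) = (\<Sum>X\<in>Pow V. (1 + z) * z ^ card X)"
    unfolding sum_Pow_insert[OF insert.hyps]
  proof (intro sum.cong refl)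
    fix X assume "X \<in> Pow V"
    then have "finite X" "x \<notin> X" using insert.hyps finite_subset by auto
    then show "z ^ card X + z ^ card (insert x X) = (1 + z) * z ^ card X"
      by (simp add: algebra_simps)
  qed
  then show ?case using insert by (simp add: sum_distrib_left[symmetric])
qed

text \<open>
  The union bound without binomial estimates: weighting a set by \<open>exp 2 ^ (card X - k) \<ge> 1\<close> turns the sum
  over large sets into a full binomial sum, at most \<open>exp (exp 2 * card V * y) \<le> exp k\<close>, divided by \<open>exp (2 * k)\<close>.
\<close>

lemma sum_large_subsets_less:
  fixes y :: real
  assumes "finite V" "0 \<le> y" "9 * real (card V) * y \<le> real k" "2 \<le> k"
  shows "(\<Sum>X\<in>{X \<in> Pow V. k \<le> card X}. 2 * y ^ card X) < 1"
proof -
  define a :: real where "a = exp 2"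
  have a: "1 \<le> a" by (simp add: a_def)
  have "a = exp 1 * exp 1" by (simp add: a_def exp_add[symmetric])
  also have "\<dots> \<le> 3 * 3" using exp_le by (intro mult_mono) auto
  finally have "a \<le> 9" by simp
  have "a ^ k * (\<Sum>X\<in>{X \<in> Pow V. k \<le> card X}. y ^ card X)
      = (\<Sum>X\<in>{X \<in> Pow V. k \<le> card X}. a ^ k * y ^ card X)" by (simp add: sum_distrib_left)
  also have "\<dots> \<le> (\<Sum>X\<in>{X \<in> Pow V. k \<le> card X}. (a * y) ^ card X)"
    unfolding power_mult_distrib using a assms(2)
    by (intro sum_mono mult_right_mono power_increasing) auto
  also have "\<dots> \<le> (\<Sum>X\<in>Pow V. (a * y) ^ card X)"
    using assms(1,2) a by (intro sum_mono2) auto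
  also have "\<dots> = (1 + a * y) ^ card V" by (rule sum_Pow_power_card[OF assms(1)])
  also have "\<dots> \<le> exp (a * y) ^ card V"
    using a assms(2) by (intro power_mono exp_ge_add_one_self) auto
  also have "\<dots> = exp (real (card V) * y * a)" by (simp add: exp_of_nat_mult[symmetric] mult_ac)
  also have "\<dots> \<le> exp (real k)"
  proof -
    have "real (card V) * y * a \<le> real (card V) * y * 9"
      using \<open>a \<le> 9\<close> assms(2) by (intro mult_left_mono) auto
    then show ?thesis using assms(3) by (simp add: mult_ac)
  qed
  finally have "a ^ k * (\<Sum>X\<in>{X \<in> Pow V. k \<le> card X}. y ^ card X) \<le> exp (real k)" .
  moreover have "a ^ k = exp (real k) * exp (real k)"
    by (simp add: a_def exp_of_nat_mult[symmetric] exp_add[symmetric])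
  ultimately have "exp (real k) * (exp (real k) * (\<Sum>X\<in>{X \<in> Pow V. k \<le> card X}. y ^ card X))
      \<le> exp (real k) * 1" by (simp add: mult_ac)
  then have "exp (real k) * (\<Sum>X\<in>{X \<in> Pow V. k \<le> card X}. y ^ card X) \<le> 1"
    by (rule mult_left_le_imp_le) simp
  moreover have "3 \<le> exp (real k)"
    using exp_ge_add_one_self[of "real k"] assms(4) by linarith
  moreover have "0 \<le> (\<Sum>X\<in>{X \<in> Pow V. k \<le> card X}. y ^ card X)"
    using assms(2) by (intro sum_nonneg) auto
  ultimately have "3 * (\<Sum>X\<in>{X \<in> Pow V. k \<le> card X}. y ^ card X) \<le> 1"
    using mult_right_mono[of 3 "exp (real k)" "\<Sum>X\<in>{X \<in> Pow V. k \<le> card X}. y ^ card X"]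
    by linarith
  then show ?thesis unfolding sum_distrib_left[symmetric] by linarith
qed

lemma sum_square_symmetric:
  fixes h :: "'a :: linorder \<Rightarrow> 'a \<Rightarrow> real"
  assumes "finite X" "\<And>u v. h u v = h v u"
  shows "(\<Sum>u\<in>X. \<Sum>v\<in>X. h u v)
    = 2 * (\<Sum>(u, v)\<in>{(u, v) \<in> X \<times> X. u < v}. h u v) + (\<Sum>u\<in>X. h u u)"
proof -
  define Q where "Q = {(u, v) \<in> X \<times> X. u < v}"
  define D where "D = (\<lambda>u. (u, u)) ` X"
  have "Q \<subseteq> X \<times> X" by (auto simp: Q_def)
  then have fin: "finite Q" "finite D"
    using assms(1) finite_subset[of Q "X \<times> X"] by (simp_all add: D_def)
  have "X \<times> X = (Q \<union> prod.swap ` Q) \<union> D"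
    by (auto simp: Q_def D_def image_iff)
  moreover have "Q \<inter> prod.swap ` Q = {}" "(Q \<union> prod.swap ` Q) \<inter> D = {}"
    by (auto simp: Q_def D_def)
  ultimately have "(\<Sum>(u, v)\<in>X \<times> X. h u v)
      = (\<Sum>(u, v)\<in>Q. h u v) + (\<Sum>(u, v)\<in>prod.swap ` Q. h u v) + (\<Sum>(u, v)\<in>D. h u v)"
    using fin by (simp add: sum.union_disjoint)
  also have "(\<Sum>(u, v)\<in>prod.swap ` Q. h u v) = (\<Sum>(u, v)\<in>Q. h v u)"
    by (subst sum.reindex) (auto simp: case_prod_unfold)
  also have "\<dots> = (\<Sum>(u, v)\<in>Q. h u v)" using assms(2) by (intro sum.cong) auto
  also have "(\<Sum>(u, v)\<in>D. h u v) = (\<Sum>u\<in>X. h u u)"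
    unfolding D_def by (subst sum.reindex) (auto simp: inj_on_def)
  finally show ?thesis by (simp add: sum.cartesian_product Q_def)
qed

section \<open>Graphs without dense sets\<close>

text \<open>
  Each potential edge is represented once, so that the graphs on \<open>{..<n}\<close> correspond to the subsets of
  this set.
\<close>

definition upper_pairs :: "nat \<Rightarrow> (nat \<times> nat) set" where
  "upper_pairs n = {(u, v). u < v \<and> v < n}"

definition graph_of :: "nat \<Rightarrow> (nat \<times> nat) set \<Rightarrow> nat pair_pre_digraph" where
  "graph_of n E = \<lparr>pverts = {..<n}, parcs = {(u, v). (u, v) \<in> E \<or> (v, u) \<in> E}\<rparr>"

lemma finite_upper_pairs: "finite (upper_pairs n)"
  by (rule finite_subset[of _ "{..<n} \<times> {..<n}"]) (auto simp: upper_pairs_def)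

lemma pair_graph_graph_of:
  assumes "E \<subseteq> upper_pairs n"
  shows "pair_graph (graph_of n E)"
proof -
  have E: "u < n \<and> v < n \<and> u \<noteq> v" if "(u, v) \<in> E \<or> (v, u) \<in> E" for u v
    using assms that unfolding upper_pairs_def by fastforce
  then have arcs: "fst e < n \<and> snd e < n \<and> fst e \<noteq> snd e" if "e \<in> parcs (graph_of n E)" for e
    using that E[of "fst e" "snd e"] by (simp add: graph_of_def case_prod_unfold)
  then have "parcs (graph_of n E) \<subseteq> {..<n} \<times> {..<n}" by (auto simp: mem_Times_iff)
  then have "finite (parcs (graph_of n E))" by (rule finite_subset) simp
  moreover have "symmetric (with_proj (graph_of n E))"
    unfolding symmetric_def sym_def by (simp add: graph_of_def disj_commute)
  moreover have "pverts (graph_of n E) = {..<n}" by (simp add: graph_of_def)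
  ultimately show ?thesis by unfold_locales (simp_all add: arcs)
qed

lemma disc_graph_of:
  assumes "E \<subseteq> upper_pairs n" "X \<subseteq> {..<n}"
  shows "disc (sign_of (graph_of n E)) X
    = 2 * signed_sum (\<lambda>p. of_bool (p \<in> X \<times> X)) (upper_pairs n) E"
proof -
  have "finite X" using assms(2) finite_subset by blast
  have inter: "upper_pairs n \<inter> (X \<times> X) = {(u, v) \<in> X \<times> X. u < v}"
    using assms(2) by (auto simp: upper_pairs_def)
  have "disc (sign_of (graph_of n E)) X
      = 2 * (\<Sum>(u, v)\<in>{(u, v) \<in> X \<times> X. u < v}. sign_of (graph_of n E) u v)"
    unfolding cross_def using \<open>finite X\<close>
    by (subst sum_square_symmetric) (auto simp: sign_of_def graph_of_def)
  also have "(\<Sum>(u, v)\<in>{(u, v) \<in> X \<times> X. u < v}. sign_of (graph_of n E) u v)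
      = (\<Sum>p\<in>upper_pairs n \<inter> (X \<times> X). if p \<in> E then 1 else - 1)"
    unfolding inter using assms(1)
    by (intro sum.cong) (auto simp: sign_of_def graph_of_def upper_pairs_def)
  also have "\<dots> = signed_sum (\<lambda>p. of_bool (p \<in> X \<times> X)) (upper_pairs n) E"
    unfolding signed_sum_def sum.inter_restrict[OF finite_upper_pairs]
    by (intro sum.cong) auto
  finally show ?thesis .
qed

lemma sum_squares_upper_pairs:
  assumes "X \<subseteq> {..<n}"
  shows "2 * (\<Sum>p\<in>upper_pairs n. (of_bool (p \<in> X \<times> X) :: real)\<^sup>2)
    = real (card X) * (real (card X) - 1)"
proof -
  have "finite X" using assms finite_subset by blast
  have inter: "upper_pairs n \<inter> (X \<times> X) = {(u, v) \<in> X \<times> X. u < v}"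
    using assms by (auto simp: upper_pairs_def)
  have "(\<Sum>p\<in>upper_pairs n. (of_bool (p \<in> X \<times> X) :: real)\<^sup>2)
      = (\<Sum>p\<in>upper_pairs n \<inter> (X \<times> X). 1)"
    unfolding sum.inter_restrict[OF finite_upper_pairs] by (intro sum.cong) auto
  then have "2 * (\<Sum>p\<in>upper_pairs n. (of_bool (p \<in> X \<times> X) :: real)\<^sup>2)
      = (\<Sum>u\<in>X. \<Sum>v\<in>X. 1) - (\<Sum>u\<in>X. 1)"
    using sum_square_symmetric[OF \<open>finite X\<close>, of "\<lambda>u v. 1"] unfolding inter
    by (simp add: case_prod_unfold)
  then show ?thesis by (simp add: algebra_simps)
qed

text \<open>
  For a set of order \<open>l\<close> the relevant sum has \<open>l (l - 1) / 2\<close> signs, and the Chernoff exponent at the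
  threshold is exactly \<open>\<nu>\<^sup>2 l ln l\<close>. Since \<open>l \<ge> k\<close>, the probability is at most \<open>y ^ l\<close>, up to a factor 2,
  with \<open>y = k powr (- \<nu>\<^sup>2)\<close>, the form needed for the union bound.
\<close>

lemma exists_graph_of_small_disc:
  assumes "2 \<le> k" "0 \<le> \<nu>" and n: "9 * real n \<le> real k powr (\<nu>\<^sup>2 + 1)"
  shows "\<exists>E\<subseteq>upper_pairs n. \<forall>X\<subseteq>{..<n}. k \<le> card X \<longrightarrow>
    \<bar>disc (sign_of (graph_of n E)) X\<bar>
      < 2 * (real (card X) * (\<nu> * sqrt ((real (card X) - 1) * ln (real (card X)))))"
proof (rule ccontr)
  define P where "P = upper_pairs n"
  define t where "t X = real (card X) * (\<nu> * sqrt ((real (card X) - 1) * ln (real (card X))))"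
    for X :: "nat set"
  define S where "S X E = signed_sum (\<lambda>p. of_bool (p \<in> X \<times> X)) P E" for X E
  define large where "large = {X \<in> Pow {..<n}. k \<le> card X}"
  define y where "y = real k powr (- (\<nu>\<^sup>2))"
  have "finite P" "finite large" by (auto simp: P_def large_def finite_upper_pairs)
  assume "\<not> ?thesis"
  then have bad: "\<exists>X\<subseteq>{..<n}. k \<le> card X \<and> 2 * t X \<le> \<bar>disc (sign_of (graph_of n E)) X\<bar>"
    if "E \<subseteq> upper_pairs n" for E
    using that unfolding t_def not_le[symmetric] by blast
  have "\<exists>X\<in>large. t X \<le> \<bar>S X E\<bar>" if E: "E \<subseteq> P" for E
  proof -
    obtain X where X: "X \<subseteq> {..<n}" "k \<le> card X"
      and "2 * t X \<le> \<bar>disc (sign_of (graph_of n E)) X\<bar>"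
      using bad E unfolding P_def by blast
    then have "t X \<le> \<bar>S X E\<bar>"
      using disc_graph_of[OF E[unfolded P_def] X(1)] by (simp add: S_def P_def abs_mult)
    then show ?thesis using X by (auto simp: large_def)
  qed
  then have "Pow P \<subseteq> (\<Union>X\<in>large. {E \<in> Pow P. t X \<le> \<bar>S X E\<bar>})" by blast
  then have "card (Pow P) \<le> card (\<Union>X\<in>large. {E \<in> Pow P. t X \<le> \<bar>S X E\<bar>})"
    using \<open>finite P\<close> \<open>finite large\<close> by (intro card_mono) auto
  also have "\<dots> \<le> (\<Sum>X\<in>large. card {E \<in> Pow P. t X \<le> \<bar>S X E\<bar>})"
    by (rule card_UN_le[OF \<open>finite large\<close>])
  finally have "real (card (Pow P)) \<le> real (\<Sum>X\<in>large. card {E \<in> Pow P. t X \<le> \<bar>S X E\<bar>})"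
    by (simp only: of_nat_le_iff)
  then have "2 ^ card P \<le> (\<Sum>X\<in>large. real (card {E \<in> Pow P. t X \<le> \<bar>S X E\<bar>}))"
    using \<open>finite P\<close> by (simp add: card_Pow)
  also have "\<dots> \<le> (\<Sum>X\<in>large. 2 ^ card P * (2 * y ^ card X))"
  proof (rule sum_mono)
    fix X assume "X \<in> large"
    then have X: "X \<subseteq> {..<n}" "k \<le> card X" by (auto simp: large_def)
    define l where "l = real (card X)"
    have l: "2 \<le> l" "real k \<le> l" using X(2) assms(1) by (auto simp: l_def)
    define s where "s = (\<Sum>p\<in>P. (of_bool (p \<in> X \<times> X) :: real)\<^sup>2)"
    have s: "2 * s = l * (l - 1)"
      unfolding s_def P_def l_def by (rule sum_squares_upper_pairs[OF X(1)])
    have "0 < l * (l - 1)" using l by (intro mult_pos_pos) auto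
    then have "0 < s" using s by linarith
    have "0 \<le> t X" using assms(2) l by (auto simp: t_def l_def[symmetric])
    have "real (card {E \<in> Pow P. t X \<le> \<bar>S X E\<bar>}) \<le> 2 * 2 ^ card P * exp (- ((t X)\<^sup>2 / (2 * s)))"
      using signed_sum_Chernoff_abs[OF \<open>finite P\<close> \<open>0 \<le> t X\<close>, of "\<lambda>p. of_bool (p \<in> X \<times> X)"] \<open>0 < s\<close>
      unfolding S_def s_def by blast
    also have "(t X)\<^sup>2 / (2 * s) = l * (\<nu>\<^sup>2 * ln l)"
    proof -
      have "(t X)\<^sup>2 = l\<^sup>2 * (\<nu>\<^sup>2 * ((l - 1) * ln l))"
        using l by (simp add: t_def l_def[symmetric] power_mult_distrib)
      then show ?thesis unfolding s using l by (simp add: power2_eq_square field_simps)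
    qed
    also have "exp (- (l * (\<nu>\<^sup>2 * ln l))) \<le> y ^ card X"
    proof -
      have "ln (real k) \<le> ln l" using l assms(1) by simp
      then have "l * (\<nu>\<^sup>2 * ln (real k)) \<le> l * (\<nu>\<^sup>2 * ln l)" using l by (intro mult_left_mono) auto
      then have "exp (- (l * (\<nu>\<^sup>2 * ln l))) \<le> exp (l * (- (\<nu>\<^sup>2) * ln (real k)))" by simp
      also have "\<dots> = y ^ card X"
        using assms(1) unfolding l_def exp_of_nat_mult by (simp add: y_def powr_def)
      finally show ?thesis .
    qed
    finally show "real (card {E \<in> Pow P. t X \<le> \<bar>S X E\<bar>}) \<le> 2 ^ card P * (2 * y ^ card X)"
      by (simp add: mult_ac)
  qed
  also have "\<dots> = 2 ^ card P * (\<Sum>X\<in>large. 2 * y ^ card X)" by (simp add: sum_distrib_left)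
  also have "\<dots> < 2 ^ card P * 1"
  proof (intro mult_strict_left_mono)
    have "9 * real n * y \<le> real k powr (\<nu>\<^sup>2 + 1) * y" using n by (intro mult_right_mono) (auto simp: y_def)
    also have "\<dots> = real k" using assms(1) by (simp add: y_def powr_add[symmetric])
    finally show "(\<Sum>X\<in>large. 2 * y ^ card X) < 1"
      unfolding large_def using assms(1)
      by (intro sum_large_subsets_less) (auto simp: y_def)
  qed simp
  finally show False by simp
qed

lemma min_degree_le_disc:
  assumes G: "pair_graph G" and H: "induced_subgraph (with_proj H) (with_proj G)"
  shows "real (card (pverts H)) * (2 * real (min_degree H) - (real (card (pverts H)) - 1))
    \<le> disc (sign_of G) (pverts H)"
proof -
  interpret pair_graph G by fact
  have "pverts H \<subseteq> pverts G" using H by (simp add: induced_subgraph_def subgraph_def)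
  then have fin: "finite (pverts H)" using finite_verts by (rule finite_subset)
  have "real (card (pverts H)) * (2 * real (min_degree H) - (real (card (pverts H)) - 1))
      = (\<Sum>x\<in>pverts H. 2 * real (min_degree H) - (real (card (pverts H)) - 1))" by simp
  also have "\<dots> \<le> (\<Sum>x\<in>pverts H. \<Sum>v\<in>pverts H. sign_of G x v)"
  proof (rule sum_mono)
    fix x assume x: "x \<in> pverts H"
    then have "min_degree H \<le> out_degree (with_proj H) x"
      unfolding min_degree_def using fin by simp
    then show "2 * real (min_degree H) - (real (card (pverts H)) - 1) \<le> (\<Sum>v\<in>pverts H. sign_of G x v)"
      using out_degree_induced[OF G H x] by linarith
  qed
  finally show ?thesis by (simp add: cross_def)
qed

text \<open>
  By monotonicity it suffices to defeat the constant surplus \<open>\<nu> k\<close>. Rounding up to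
  an integer number of vertices at most doubles it, which turns \<open>1/9\<close> into the constant \<open>1/18\<close>; when the bound
  is below 1, a single vertex suffices.
\<close>

lemma quasi_Ramsey_lower_bound_at:
  fixes \<nu> :: "nat \<Rightarrow> real"
  assumes mono: "mono_on {1..} \<nu>" and nonneg: "\<forall>n\<ge>1. \<nu> n \<ge> 0" and k: "2 \<le> k"
  shows "\<exists>G :: nat pair_pre_digraph. pair_graph G \<and>
    1/18 * real k powr ((\<nu> k)\<^sup>2 + 1) \<le> real (card (pverts G)) \<and>
    (\<forall>(H :: nat pair_pre_digraph) l.
       (induced_subgraph (with_proj H) (with_proj G) \<or>
        induced_subgraph (with_proj H) (with_proj (complement G))) \<longrightarrow>
       card (pverts H) = l \<longrightarrow> l \<ge> k \<longrightarrow>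
       real (min_degree H) < 1/2 * (real l - 1) + \<nu> l * sqrt ((real l - 1) * ln (real l)))"
proof -
  define x where "x = 1/18 * real k powr ((\<nu> k)\<^sup>2 + 1)"
  define n where "n = nat \<lceil>x\<rceil>"
  have "0 < x" using k by (simp add: x_def)
  then have n_ge: "x \<le> real n" by (simp add: n_def)
  have \<nu>k: "0 \<le> \<nu> k" using nonneg k by simp
  define r where "r l = sqrt ((real l - 1) * ln (real l))" for l :: nat
  have "\<exists>E\<subseteq>upper_pairs n. \<forall>X\<subseteq>{..<n}. k \<le> card X \<longrightarrow>
      \<bar>disc (sign_of (graph_of n E)) X\<bar> < 2 * (real (card X) * (\<nu> k * r (card X)))"
  proof (cases "x \<le> 1")
    case True
    then have "n \<le> 1" by (simp add: n_def)
    have "card X < k" if "X \<subseteq> {..<n}" for X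
    proof -
      have "card X \<le> n" using card_mono[OF _ that] by simp
      then show ?thesis using \<open>n \<le> 1\<close> k by simp
    qed
    then show ?thesis by (meson empty_subsetI leD)
  next
    case False
    then have "real n \<le> 2 * x" unfolding n_def by linarith
    then have "9 * real n \<le> real k powr ((\<nu> k)\<^sup>2 + 1)" by (simp add: x_def)
    then show ?thesis unfolding r_def by (rule exists_graph_of_small_disc[OF k \<nu>k])
  qed
  then obtain E where E: "E \<subseteq> upper_pairs n"
    and small: "\<And>X. X \<subseteq> {..<n} \<Longrightarrow> k \<le> card X \<Longrightarrow>
      \<bar>disc (sign_of (graph_of n E)) X\<bar> < 2 * (real (card X) * (\<nu> k * r (card X)))"
    by blast
  define G where "G = graph_of n E"
  have G: "pair_graph G" unfolding G_def by (rule pair_graph_graph_of[OF E])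
  have [simp]: "pverts G = {..<n}" by (simp add: G_def graph_of_def)
  have "real (min_degree H) < 1/2 * (real l - 1) + \<nu> l * r l"
    if ind: "induced_subgraph (with_proj H) (with_proj G) \<or>
        induced_subgraph (with_proj H) (with_proj (complement G))"
      and l: "card (pverts H) = l" "l \<ge> k" for H l
  proof -
    have sub: "pverts H \<subseteq> {..<n}"
      using ind by (auto simp: induced_subgraph_def subgraph_def complement_def)
    have "real l * (2 * real (min_degree H) - (real l - 1)) \<le> \<bar>disc (sign_of G) (pverts H)\<bar>"
      using ind
    proof
      assume "induced_subgraph (with_proj H) (with_proj G)"
      from min_degree_le_disc[OF G this]
      have "real l * (2 * real (min_degree H) - (real l - 1)) \<le> disc (sign_of G) (pverts H)"
        using l by simp
      then show ?thesis by (rule order_trans) (rule abs_ge_self)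
    next
      assume "induced_subgraph (with_proj H) (with_proj (complement G))"
      from min_degree_le_disc[OF pair_graph_complement[OF G] this]
      have "real l * (2 * real (min_degree H) - (real l - 1))
        \<le> disc (sign_of (complement G)) (pverts H)" using l by simp
      also have "\<dots> = - disc (sign_of G) (pverts H)"
        unfolding cross_def sum_negf[symmetric] using sub
        by (intro sum.cong refl sign_of_complement) auto
      finally show ?thesis by (rule order_trans) (rule abs_ge_minus_self)
    qed
    also have "\<dots> < 2 * (real l * (\<nu> k * r l))"
      using small[OF sub] l by (simp add: G_def)
    also have "\<dots> \<le> 2 * (real l * (\<nu> l * r l))"
    proof -
      have "\<nu> k \<le> \<nu> l" using mono l(2) k by (auto simp: mono_on_def)
      moreover have "0 \<le> r l" using l(2) k by (simp add: r_def)
      ultimately show ?thesis by (intro mult_left_mono mult_right_mono) auto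
    qed
    finally have "real l * (2 * real (min_degree H) - (real l - 1)) < real l * (2 * (\<nu> l * r l))"
      by (simp add: mult_ac)
    then have "2 * real (min_degree H) - (real l - 1) < 2 * (\<nu> l * r l)"
      by (rule mult_left_less_imp_less) simp
    then show ?thesis by (simp add: field_simps)
  qed
  then show ?thesis using G n_ge unfolding x_def r_def by (intro exI[of _ G]) auto
qed

theorem theorem3:
  shows
    "(\<forall>(\<nu>::real) (c::real). \<nu> \<ge> 0 \<longrightarrow> c > 4/3 \<longrightarrow>
        (\<forall>\<^sub>F k::nat in sequentially.
          \<forall>G :: 'a pair_pre_digraph.
            pair_graph G \<longrightarrow>
            real (card (pverts G)) \<ge> real k powr (c * 10^6 * \<nu>\<^sup>2 + 4/3) \<longrightarrow>
            (\<exists>(H :: 'a pair_pre_digraph) l.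
                (induced_subgraph (with_proj H) (with_proj G) \<or>
                 induced_subgraph (with_proj H) (with_proj (complement G))) \<and>
                card (pverts H) = l \<and> l \<ge> k \<and>
                real (min_degree H) \<ge>
                  1/2 * (real l - 1) + \<nu> * sqrt ((real l - 1) * ln (real l)))))
     \<and>
     (\<exists>C::real. C > 0 \<and>
        (\<forall>\<nu> :: nat \<Rightarrow> real.
          mono_on {1..} \<nu> \<longrightarrow> (\<forall>n\<ge>1. \<nu> n \<ge> 0) \<longrightarrow>
          (\<forall>\<^sub>F k::nat in sequentially.
            \<exists>G :: nat pair_pre_digraph.
              pair_graph G \<and>
              real (card (pverts G)) \<ge> C * real k powr ((\<nu> k)\<^sup>2 + 1) \<and>
              (\<forall>(H :: nat pair_pre_digraph) l.
                 (induced_subgraph (with_proj H) (with_proj G) \<or>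
                  induced_subgraph (with_proj H) (with_proj (complement G))) \<longrightarrow>
                 card (pverts H) = l \<longrightarrow> l \<ge> k \<longrightarrow>
                 real (min_degree H) <
                   1/2 * (real l - 1) + \<nu> l * sqrt ((real l - 1) * ln (real l))))))"
proof (intro conjI allI impI)
  fix \<nu> c :: real
  assume "\<nu> \<ge> 0" "c > 4/3"
  then show "\<forall>\<^sub>F k::nat in sequentially.
          \<forall>G :: 'a pair_pre_digraph.
            pair_graph G \<longrightarrow>
            real (card (pverts G)) \<ge> real k powr (c * 10^6 * \<nu>\<^sup>2 + 4/3) \<longrightarrow>
            (\<exists>(H :: 'a pair_pre_digraph) l.
                (induced_subgraph (with_proj H) (with_proj G) \<or>
                 induced_subgraph (with_proj H) (with_proj (complement G))) \<and>
                card (pverts H) = l \<and> l \<ge> k \<and>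
                real (min_degree H) \<ge>
                  1/2 * (real l - 1) + \<nu> * sqrt ((real l - 1) * ln (real l)))"
    by (rule quasi_Ramsey_upper_bound)
next
  show "\<exists>C::real. C > 0 \<and>
        (\<forall>\<nu> :: nat \<Rightarrow> real.
          mono_on {1..} \<nu> \<longrightarrow> (\<forall>n\<ge>1. \<nu> n \<ge> 0) \<longrightarrow>
          (\<forall>\<^sub>F k::nat in sequentially.
            \<exists>G :: nat pair_pre_digraph.
              pair_graph G \<and>
              real (card (pverts G)) \<ge> C * real k powr ((\<nu> k)\<^sup>2 + 1) \<and>
              (\<forall>(H :: nat pair_pre_digraph) l.
                 (induced_subgraph (with_proj H) (with_proj G) \<or>
                  induced_subgraph (with_proj H) (with_proj (complement G))) \<longrightarrow>
                 card (pverts H) = l \<longrightarrow> l \<ge> k \<longrightarrow>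
                 real (min_degree H) <
                   1/2 * (real l - 1) + \<nu> l * sqrt ((real l - 1) * ln (real l)))))"
  proof (intro exI[of _ "1/18"] conjI allI impI)
    fix \<nu> :: "nat \<Rightarrow> real"
    assume \<nu>: "mono_on {1..} \<nu>" "\<forall>n\<ge>1. \<nu> n \<ge> 0"
    show "\<forall>\<^sub>F k::nat in sequentially.
            \<exists>G :: nat pair_pre_digraph.
              pair_graph G \<and>
              real (card (pverts G)) \<ge> 1/18 * real k powr ((\<nu> k)\<^sup>2 + 1) \<and>
              (\<forall>(H :: nat pair_pre_digraph) l.
                 (induced_subgraph (with_proj H) (with_proj G) \<or>
                  induced_subgraph (with_proj H) (with_proj (complement G))) \<longrightarrow>
                 card (pverts H) = l \<longrightarrow> l \<ge> k \<longrightarrow>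
                 real (min_degree H) <
                   1/2 * (real l - 1) + \<nu> l * sqrt ((real l - 1) * ln (real l)))"
      by (rule eventually_sequentiallyI[of 2]) (rule quasi_Ramsey_lower_bound_at[OF \<nu>])
  qed simp
qed

end
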